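(* Let $c_1,c_2\ge0$, $b_1,b_2>0$, let $D=[c_1,c_1+b_1]\times[c_2,c_2+b_2]$, and let the buyer's valuation $z$ be uniformly distributed on $D$. Suppose $c_2\le b_2$ and $$\frac{2b_1(b_2+c_2)}{b_2+3c_2}\le c_1\le 2b_1\Big(\frac{b_2}{b_2-c_2}\Big)^2$$ (the upper bound being $+\infty$ when $c_2=b_2$). Then there exists $p_{a_2}\in[(2b_1-c_1)_+,b_1]$ that solves $$2b_1^2b_2^2c_1-c_1^2b_1(b_2-c_2)^2+p_{a_2}\big(2b_1^2b_2^2-4b_1b_2c_1c_2-3c_1b_1(b_2-c_2)^2\big)+p_{a_2}^2\big(2c_2^2c_1-4b_1b_2c_2-\tfrac94b_1(b_2-c_2)^2\big)+2c_2^2p_{a_2}^3=0.$$ Let $a_2$ be given by $$a_2=p_{a_2}\left(\frac{\frac32p_{a_2}+c_1}{b_1b_2-c_2p_{a_2}}\right)=\frac{p_{a_2}}{b_2-c_2}\sqrt{\frac{2(p_{a_2}+c_1)}{b_1}}$$ (with $a_2=+\infty$ when $c_2=b_2$). If $a_2\le1$, then the optimal mechanism is the one induced by the menu consisting of $(0,0)$ at price $0$, $(1,a_2)$ at price $c_1+a_2c_2+p_{a_2}$, and $(1,1)$ at price $c_1+c_2+p_{a_2}+(1-a_2)(b_2-c_2)/2$; in it the allocation is $(0,0)$ where $(z_1-c_1)+a_2(z_2-c_2)<p_{a_2}$, it is $(1,1)$ where $z_2>c_2+p$ with $p=(b_2-c_2)/2$ (i.e. $z_2>(c_2+b_2)/2$),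 and it is $(1,a_2)$ on the rest of $D$ (up to boundaries). If instead $a_2>1$, then the optimal mechanism is pure bundling: the menu $(0,0)$ at price $0$ and $(1,1)$ at price $c_1+c_2+p^*$, where $$p^*=\frac{\sqrt{(c_1+c_2)^2+6b_1b_2}-c_1-c_2}{3}.$$
   Context: Notation: $x_+=\max(x,0)$. A seller sells two items to one buyer with valuation $z=(z_1,z_2)\in D$. A (direct) mechanism is a pair of an allocation function $q:D\to[0,1]^2$ and a payment function $t:D\to\mathbb{R}_{\ge0}$. It is incentive compatible if $z\cdot q(z)-t(z)\ge z\cdot q(\hat z)-t(\hat z)$ for all $z,\hat z\in D$, and individually rational if $z\cdot q(z)-t(z)\ge0$ for all $z\in D$. A mechanism is optimal if it maximizes the expected revenue $\mathbb{E}[t(z)]$ among all incentive compatible and individually rational mechanisms. "The optimal mechanism is X" means that mechanism X is optimal. A menu is a finite set of pairs (allocation, price). The mechanism induced by a menu assigns to each $z\in D$ an allocation $q$ and price $t$ from the menu maximizing $z\cdot q-t$ (ties broken arbitrarily). *)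

theory Defs
  imports "HOL-Analysis.Analysis"
begin

type_synonym alloc = "real \<times> real"
type_synonym valuation = "real \<times> real"

text \<open>
  A mechanism on \<open>D\<close> is given by an allocation \<open>q\<close> and a payment \<open>t\<close>; only their values on \<open>D\<close>
  matter. The operator \<open>\<bullet>\<close> is the inner product of the plane.
\<close>

definition mechanism :: "valuation set \<Rightarrow> (valuation \<Rightarrow> alloc) \<Rightarrow> (valuation \<Rightarrow> real) \<Rightarrow> bool" where
  "mechanism D q t \<longleftrightarrow> (\<forall>z\<in>D. q z \<in> {0..1} \<times> {0..1} \<and> 0 \<le> t z)"

definition incentive_compatible :: "valuation set \<Rightarrow> (valuation \<Rightarrow> alloc) \<Rightarrow> (valuation \<Rightarrow> real) \<Rightarrow> bool" where
  "incentive_compatible D q t \<longleftrightarrow> (\<forall>z\<in>D. \<forall>z'\<in>D. z \<bullet> q z - t z \<ge> z \<bullet> q z' - t z')"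

definition individually_rational :: "valuation set \<Rightarrow> (valuation \<Rightarrow> alloc) \<Rightarrow> (valuation \<Rightarrow> real) \<Rightarrow> bool" where
  "individually_rational D q t \<longleftrightarrow> (\<forall>z\<in>D. z \<bullet> q z - t z \<ge> 0)"

text \<open>
  Expected revenue for a valuation uniformly distributed on \<open>D\<close>. No measurability is imposed on
  \<open>t\<close>: on a rectangle the utility \<open>z \<bullet> q z - t z\<close> of an incentive compatible mechanism is convex
  and \<open>q\<close> is almost everywhere its gradient, so \<open>t\<close> is automatically Lebesgue measurable (though
  not Borel, whence the complete measure). Restricting to \<open>D\<close> makes the integral independent of
  the values of \<open>t\<close> outside \<open>D\<close>.
\<close>

definition revenue :: "valuation set \<Rightarrow> (valuation \<Rightarrow> real) \<Rightarrow> real" where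
  "revenue D t = (LINT z|uniform_measure (lebesgue_on D) D. t z)"

definition optimal :: "valuation set \<Rightarrow> (valuation \<Rightarrow> alloc) \<Rightarrow> (valuation \<Rightarrow> real) \<Rightarrow> bool" where
  "optimal D q t \<longleftrightarrow>
     mechanism D q t \<and> incentive_compatible D q t \<and> individually_rational D q t \<and>
     (\<forall>q' t'. mechanism D q' t' \<and> incentive_compatible D q' t' \<and> individually_rational D q' t'
        \<longrightarrow> revenue D t' \<le> revenue D t)"

text \<open>
  \<open>induced D M q t\<close>: the mechanism \<open>(q, t)\<close> arises from the menu \<open>M\<close> of pairs (allocation, price)
  by some way of breaking ties.
\<close>

definition induced ::
  "valuation set \<Rightarrow> (alloc \<times> real) set \<Rightarrow> (valuation \<Rightarrow> alloc) \<Rightarrow> (valuation \<Rightarrow> real) \<Rightarrow> bool" where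
  "induced D M q t \<longleftrightarrow> finite M \<and>
     (\<forall>z\<in>D. (q z, t z) \<in> M \<and> (\<forall>(a, x)\<in>M. z \<bullet> a - x \<le> z \<bullet> q z - t z))"

text \<open>The mechanism induced by \<open>M\<close> exists and is optimal however ties are broken.\<close>

definition optimal_menu :: "valuation set \<Rightarrow> (alloc \<times> real) set \<Rightarrow> bool" where
  "optimal_menu D M \<longleftrightarrow>
     (\<exists>q t. induced D M q t) \<and> (\<forall>q t. induced D M q t \<longrightarrow> optimal D q t)"

text \<open>The two expressions for \<open>a\<^sub>2\<close> as functions of \<open>p = p\<^sub>a\<^sub>2\<close>.\<close>

definition a2 :: "real \<Rightarrow> real \<Rightarrow> real \<Rightarrow> real \<Rightarrow> real \<Rightarrow> ereal" where
  "a2 c1 c2 b1 b2 p =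
     (if c2 = b2 then \<infinity> else ereal (p * ((3/2 * p + c1) / (b1 * b2 - c2 * p))))"

definition a2' :: "real \<Rightarrow> real \<Rightarrow> real \<Rightarrow> real \<Rightarrow> real \<Rightarrow> ereal" where
  "a2' c1 c2 b1 b2 p =
     (if c2 = b2 then \<infinity> else ereal (p / (b2 - c2) * sqrt (2 * (p + c1) / b1)))"

definition a2_menu :: "real \<Rightarrow> real \<Rightarrow> real \<Rightarrow> real \<Rightarrow> real \<Rightarrow> (alloc \<times> real) set" where
  "a2_menu c1 c2 b2 p a =
     {((0, 0), 0),
      ((1, a), c1 + a * c2 + p),
      ((1, 1), c1 + c2 + p + (1 - a) * (b2 - c2) / 2)}"

definition bundling_menu :: "real \<Rightarrow> real \<Rightarrow> real \<Rightarrow> real \<Rightarrow> (alloc \<times> real) set" where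
  "bundling_menu c1 c2 b1 b2 =
     {((0, 0), 0),
      ((1, 1), c1 + c2 + (sqrt ((c1 + c2)^2 + 6 * b1 * b2) - c1 - c2) / 3)}"

end

theory Submission
  imports Defs
begin

text \<open>
  Integrating by parts along lines turns the revenue of a mechanism into a linear functional of its
  utility \<open>u\<close>: positive mass on the right and top edges of the rectangle, negative mass on the left
  and bottom edges and in the interior. Let \<open>d\<close> be the difference between the utility of an
  arbitrary mechanism and that of the claimed optimum. Outside the region where nothing is sold,
  \<open>d\<close> decreases in \<open>x\<close>, and above a height \<open>n\<close> it decreases in \<open>y\<close>; where nothing is
  sold it is nonnegative. Moving positive mass to the left or down and negative mass to the right
  therefore only increases the functional of \<open>d\<close>. Above \<open>n\<close> everything can be cancelled this way.
  Below \<open>n\<close> each horizontal line is spread uniformly over \<open>[p, b1]\<close>, which leaves a signed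
  measure in \<open>y\<close> alone, tested against the average \<open>\<psi>\<close> of \<open>d\<close> over \<open>[p, b1]\<close>. There
  \<open>\<psi>\<close> is convex, and the two expressions for \<open>a\<^sub>2\<close> say that the measure has total mass zero and
  first moment zero. As its sign pattern is negative, positive, negative, its integral against a
  convex function is nonpositive. For bundling the first moment is only nonnegative, but then
  \<open>\<psi>\<close> is also decreasing.
\<close>

subsection \<open>Revenue as a linear functional of the utility\<close>

text \<open>The constants come from counting mass. A horizontal line carries \<open>c1 + b1\<close>
  on the right edge, \<open>- c1\<close> on the left edge and \<open>- 3 * b1\<close> inside (two
  parts from the divergence, one from the utility itself), in total \<open>- 2 * b1\<close>. The top
  edge carries \<open>(c2 + b2) * b1\<close>, which cancels lines of total height
  \<open>(c2 + b2) / 2\<close>; hence the change of allocation at height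
  \<open>(b2 - c2) / 2\<close>. The obstacle is that a difference of two convex utilities need not
  be convex, so vanishing mass and moment would say nothing about \<open>d\<close> itself. But the
  region without sale meets the bottom edge at \<open>p\<close>, so for \<open>p \<le> x\<close> and
  below \<open>n\<close> the claimed utility is affine in \<open>y\<close>, and there
  \<open>d\<close> inherits convexity in \<open>y\<close> from the competitor. This dictates
  averaging over \<open>[p, b1]\<close>. Bundling can degenerate: \<open>p\<close> may exceed
  \<open>(b2 - c2) / 2\<close>, so that the top edge carries more than is needed above
  \<open>p\<close>, and the density of the lines may have a first moment of the wrong sign. The
  lower bound on \<open>c1\<close> controls that case.\<close>

lemma shifted_difference_quotient_integral:
  fixes v :: "real \<Rightarrow> real"
  assumes lip: "\<And>x y. \<bar>v x - v y\<bar> \<le> \<bar>x - y\<bar>" and "0 \<le> c" "0 < b" "h \<noteq> 0" "\<bar>h\<bar> \<le> 1"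
  shows "\<bar>integral {0..b} (\<lambda>x. (c + x) * ((v (x + h) - v x) / h))
           - ((c + b) * v b - c * v 0 - integral {0..b} v)\<bar> \<le> 2 * (c + b) * \<bar>h\<bar>"
proof -
  have vc: "continuous_on S v" for S
    using lip by (intro lipschitz_on_continuous_on[where L=1]) (auto simp: lipschitz_on_def dist_real_def)
  \<comment> \<open>\<open>v\<close> is merely Lipschitz, so the shift is transferred to
    antiderivatives, which are differentiable. They live on an interval wider than
    \<open>[0, b]\<close> because arguments shifted by up to 1 occur.\<close>
  have ex: "\<exists>g. \<forall>x\<in>{-2<..<b+2}. (g has_real_derivative f x) (at x)" if fc: "continuous_on UNIV f" for f
  proof -
    obtain g where g: "\<And>x. x \<in> {-2..b+2} \<Longrightarrow> (g has_vector_derivative f x) (at x within {-2..b+2})"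
      using antiderivative_continuous[of "-2" "b+2" f] continuous_on_subset[OF fc] by (metis top_greatest)
    have "(g has_real_derivative f x) (at x)" if x: "x \<in> {-2<..<b+2}" for x
    proof -
      have "at x within {-2..b+2} = at x" using x by (intro at_within_interior) (auto simp: interior_atLeastAtMost_real)
      then show ?thesis using g[of x] x by (auto simp: has_real_derivative_iff_has_vector_derivative)
    qed
    then show ?thesis by blast
  qed
  obtain V where V: "\<And>x. x \<in> {-2<..<b+2} \<Longrightarrow> (V has_real_derivative v x) (at x)" using ex[OF vc] by blast
  have "continuous_on UNIV (\<lambda>x. (c + x) * v x)" by (intro continuous_intros vc)
  then obtain P where P: "\<And>x. x \<in> {-2<..<b+2} \<Longrightarrow> (P has_real_derivative (c + x) * v x) (at x)"
    using ex by blast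
  \<comment> \<open>Substituting \<open>x + t\<close> shows that this is the integral of
    \<open>(c + x) * v (x + t)\<close> over \<open>[0, b]\<close>. Its derivative at
    \<open>0\<close> is the integrated-by-parts expression in the conclusion.\<close>
  define N where "N = (\<lambda>t. P (b + t) - P t - t * (V (b + t) - V t))"
  have N': "(N has_real_derivative ((c + b) * v (b + t) - c * v t - (V (b + t) - V t))) (at t)" if t: "\<bar>t\<bar> \<le> 1" for t
  proof -
    have m2: "b + t \<in> {-2<..<b+2}" using t \<open>0 < b\<close> by (auto simp: abs_le_iff)
    have d: "((\<lambda>t. V (b + t)) has_real_derivative v (b + t)) (at t)" "((\<lambda>t. P (b + t)) has_real_derivative (c + (b + t)) * v (b + t)) (at t)"
      using V[OF m2] P[OF m2] by (auto intro!: DERIV_shift[THEN iffD1] simp: add.commute)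
    have m: "t \<in> {-2<..<b+2}" using t \<open>0 < b\<close> by auto
    show ?thesis unfolding N_def
      by (rule derivative_eq_intros d V[OF m] P[OF m] refl)+ (simp add: algebra_simps)
  qed
  have N: "integral {0..b} (\<lambda>x. (c + x) * v (x + t)) = N t" if t: "\<bar>t\<bar> \<le> 1" for t
  proof -
    have "((\<lambda>x. (c + x) * v (x + t)) has_integral ((P (b + t) - t * V (b + t)) - (P (0 + t) - t * V (0 + t)))) {0..b}"
    proof (rule fundamental_theorem_of_calculus)
      fix x assume x: "x \<in> {0..b}"
      then have m: "x + t \<in> {-2<..<b+2}" using t by auto
      have d: "((\<lambda>t'. V (t' + t)) has_real_derivative v (x + t)) (at x)" "((\<lambda>t'. P (t' + t)) has_real_derivative (c + (x + t)) * v (x + t)) (at x)"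
        using V[OF m] P[OF m] by (auto intro!: DERIV_shift[THEN iffD1])
      have "((\<lambda>x. P (x + t) - t * V (x + t)) has_real_derivative (c + x) * v (x + t)) (at x)"
        by (rule derivative_eq_intros d refl)+ (simp add: algebra_simps)
      then show "((\<lambda>x. P (x + t) - t * V (x + t)) has_vector_derivative (c + x) * v (x + t)) (at x within {0..b})"
        by (simp add: has_real_derivative_iff_has_vector_derivative has_vector_derivative_at_within)
    qed (use \<open>0 < b\<close> in auto)
    then show ?thesis by (auto simp: N_def algebra_simps dest: integral_unique)
  qed
  have Vb: "integral {0..b} v = V b - V 0"
    using V \<open>0 < b\<close> by (intro integral_unique fundamental_theorem_of_calculus)
      (auto simp: has_real_derivative_iff_has_vector_derivative[symmetric] intro!: DERIV_subset[OF V])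
  have Vbound: "\<bar>(V (b + t) - V t) - (V b - V 0)\<bar> \<le> b * \<bar>t\<bar>" if t: "\<bar>t\<bar> \<le> 1" for t
  proof -
    have "((\<lambda>x. V (x + t) - V x) has_real_derivative (v (x + t) - v x)) (at x)" if "0 \<le> x" "x \<le> b" for x
    proof -
      have "((\<lambda>t'. V (t' + t)) has_real_derivative v (x + t)) (at x)"
        using V[of "x+t"] t that by (auto intro!: DERIV_shift[THEN iffD1] simp: abs_le_iff)
      then show ?thesis using V[of x] that t by (auto intro!: derivative_eq_intros)
    qed
    from MVT2[OF \<open>0 < b\<close> this] obtain z where
      "(V (b + t) - V b) - (V (0 + t) - V 0) = (b - 0) * (v (z + t) - v z)" by blast
    then have "\<bar>(V (b + t) - V t) - (V b - V 0)\<bar> = b * \<bar>v (z + t) - v z\<bar>"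
      using \<open>0 < b\<close> by (simp add: algebra_simps abs_mult_pos' flip: abs_mult)
    also have "\<dots> \<le> b * \<bar>t\<bar>" using lip[of "z+t" z] \<open>0 < b\<close> by (intro mult_left_mono) auto
    finally show ?thesis .
  qed
  \<comment> \<open>The difference quotient of \<open>N\<close> is its derivative at an intermediate
    \<open>t\<close>. Comparing with the derivative at \<open>0\<close> costs \<open>c + b\<close>,
    \<open>c\<close> and \<open>b\<close> times the shift, which gives
    \<open>2 * (c + b)\<close>.\<close>
  have mvt: "\<exists>t. \<bar>t\<bar> \<le> \<bar>h\<bar> \<and> N h - N 0 = h * ((c + b) * v (b + t) - c * v t - (V (b + t) - V t))"
  proof (cases "h > 0")
    case True
    have "\<exists>z. z > 0 \<and> z < h \<and> N h - N 0 = (h - 0) * ((c + b) * v (b + z) - c * v z - (V (b + z) - V z))"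
      by (rule MVT2[OF True]) (use \<open>\<bar>h\<bar> \<le> 1\<close> in \<open>auto intro!: N'\<close>)
    then obtain z where "z > 0" "z < h" "N h - N 0 = (h - 0) * ((c + b) * v (b + z) - c * v z - (V (b + z) - V z))"
      by blast
    then show ?thesis by (intro exI[of _ z]) auto
  next
    case False
    then have h: "h < 0" using \<open>h \<noteq> 0\<close> by simp
    have "\<exists>z. z > h \<and> z < 0 \<and> N 0 - N h = (0 - h) * ((c + b) * v (b + z) - c * v z - (V (b + z) - V z))"
      by (rule MVT2[OF h]) (use \<open>\<bar>h\<bar> \<le> 1\<close> in \<open>auto intro!: N'\<close>)
    then obtain z where "z > h" "z < 0" "N 0 - N h = - h * ((c + b) * v (b + z) - c * v z - (V (b + z) - V z))"
      by auto
    then show ?thesis by (intro exI[of _ z]) (auto simp: algebra_simps)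
  qed
  then obtain t where t: "\<bar>t\<bar> \<le> \<bar>h\<bar>" "N h - N 0 = h * ((c + b) * v (b + t) - c * v t - (V (b + t) - V t))" by blast
  have "integral {0..b} (\<lambda>x. (c + x) * ((v (x + h) - v x) / h))
      = integral {0..b} (\<lambda>x. ((c + x) * v (x + h) - (c + x) * v (x + 0)) * (1/h))"
    by (intro arg_cong[where f="integral _"] ext) (simp add: field_simps)
  also have "\<dots> = (N h - N 0) * (1/h)"
    using N[OF \<open>\<bar>h\<bar> \<le> 1\<close>] N[of 0]
    by (subst integral_mult_left, subst integral_diff)
      (auto intro!: integrable_continuous_interval continuous_intros continuous_on_compose2[OF vc[of UNIV]])
  also have "\<dots> = (c + b) * v (b + t) - c * v t - (V (b + t) - V t)" using t(2) \<open>h \<noteq> 0\<close> by simp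
  finally have eq: "integral {0..b} (\<lambda>x. (c + x) * ((v (x + h) - v x) / h)) = \<dots>" .
  have 1: "\<bar>(c + b) * (v (b + t) - v b)\<bar> \<le> (c + b) * \<bar>t\<bar>" 
    using lip[of "b+t" b] assms by (auto simp: abs_mult intro!: mult_left_mono)
  have 2: "\<bar>c * (v t - v 0)\<bar> \<le> c * \<bar>t\<bar>" 
    using lip[of "t" 0] assms by (auto simp: abs_mult intro!: mult_left_mono)
  have 3: "2 * (c + b) * \<bar>t\<bar> \<le> 2 * (c + b) * \<bar>h\<bar>" using t assms by (intro mult_left_mono) auto
  have 4: "\<bar>(V (b + t) - V t) - (V b - V 0)\<bar> \<le> b * \<bar>t\<bar>" using t(1) \<open>\<bar>h\<bar> \<le> 1\<close> by (intro Vbound) linarith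
  show ?thesis unfolding eq Vb using 1 2 3 4 by (simp add: distrib_left distrib_right right_diff_distrib abs_le_iff)
qed

text \<open>
  The area of the rectangle times the revenue, after integration by parts. The arguments of \<open>u\<close>
  are relative to the lower left corner \<open>(c1, c2)\<close>.
\<close>

definition virtual_surplus :: "real \<Rightarrow> real \<Rightarrow> real \<Rightarrow> real \<Rightarrow> (real \<Rightarrow> real \<Rightarrow> real) \<Rightarrow> real" where
  "virtual_surplus c1 c2 b1 b2 u =
     integral {0..b2} (\<lambda>y. (c1 + b1) * u b1 y - c1 * u 0 y - 3 * integral {0..b1} (\<lambda>x. u x y))
     + integral {0..b1} (\<lambda>x. (c2 + b2) * u x b2 - c2 * u x 0)"

text \<open>Convexity, monotonicity and the slope bound 1 in one condition. The slopes are explicit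
  functions because they are the allocation, whose values enter the payment.\<close>

definition bounded_subgradient ::
  "real \<Rightarrow> real \<Rightarrow> (real \<Rightarrow> real \<Rightarrow> real) \<Rightarrow> (real \<Rightarrow> real \<Rightarrow> real) \<Rightarrow> (real \<Rightarrow> real \<Rightarrow> real) \<Rightarrow> bool" where
  "bounded_subgradient b1 b2 u g1 g2 \<longleftrightarrow> (\<forall>x\<in>{0..b1}. \<forall>y\<in>{0..b2}.
     g1 x y \<in> {0..1} \<and> g2 x y \<in> {0..1} \<and>
     (\<forall>x'\<in>{0..b1}. \<forall>y'\<in>{0..b2}. u x y + (x' - x) * g1 x y + (y' - y) * g2 x y \<le> u x' y'))"

lemma separately_lipschitz_imp_continuous_on:
  fixes v :: "real \<Rightarrow> real \<Rightarrow> real"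
  assumes "\<And>x x' y. \<bar>v x y - v x' y\<bar> \<le> \<bar>x - x'\<bar>" "\<And>x y y'. \<bar>v x y - v x y'\<bar> \<le> \<bar>y - y'\<bar>"
  shows "continuous_on S (\<lambda>(x, y). v x y)"
proof (rule lipschitz_on_continuous_on[where L = 2], rule lipschitz_onI)
  fix z w :: "real \<times> real"
  have "\<bar>v (fst z) (snd z) - v (fst w) (snd w)\<bar> \<le> \<bar>fst z - fst w\<bar> + \<bar>snd z - snd w\<bar>"
    using assms(1)[of "fst z" "snd z" "fst w"] assms(2)[of "fst w" "snd z" "snd w"] by linarith
  also have "\<dots> \<le> dist z w + dist z w"
    using dist_fst_le[of z w] dist_snd_le[of z w] by (intro add_mono) (auto simp: dist_real_def)
  finally show "dist (case z of (x, y) \<Rightarrow> v x y) (case w of (x, y) \<Rightarrow> v x y) \<le> 2 * dist z w"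
    by (simp add: dist_real_def case_prod_beta)
qed auto

lemma has_integral_rectangle:
  fixes f :: "real \<Rightarrow> real \<Rightarrow> real"
  assumes "continuous_on ({a..b} \<times> {c..d}) (\<lambda>(x, y). f x y)"
  shows "((\<lambda>(x, y). f x y) has_integral integral {a..b} (\<lambda>x. integral {c..d} (f x))) ({a..b} \<times> {c..d})"
    and "integral {a..b} (\<lambda>x. integral {c..d} (f x)) = integral {c..d} (\<lambda>y. integral {a..b} (\<lambda>x. f x y))"
proof -
  have "continuous_on (cbox (a, c) (b, d)) (\<lambda>(x, y). f x y)" using assms by (simp add: cbox_Pair_eq)
  from integrable_integral[OF integrable_continuous[OF this]] integral_prod_continuous[OF this] integral_swap_continuous[OF this]
  show "((\<lambda>(x, y). f x y) has_integral integral {a..b} (\<lambda>x. integral {c..d} (f x))) ({a..b} \<times> {c..d})"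
    "integral {a..b} (\<lambda>x. integral {c..d} (f x)) = integral {c..d} (\<lambda>y. integral {a..b} (\<lambda>x. f x y))"
    by (simp_all add: cbox_Pair_eq)
qed

lemma continuous_on_slices:
  fixes f :: "real \<Rightarrow> real \<Rightarrow> real"
  assumes "continuous_on (X \<times> Y) (\<lambda>(x, y). f x y)"
  shows "y \<in> Y \<Longrightarrow> continuous_on X (\<lambda>x. f x y)" "x \<in> X \<Longrightarrow> continuous_on Y (f x)"
proof -
  show "continuous_on X (\<lambda>x. f x y)" if "y \<in> Y"
  proof -
    have "continuous_on X (\<lambda>x. case (x, y) of (x, y) \<Rightarrow> f x y)"
      by (rule continuous_on_compose2[OF assms]) (use that in \<open>auto intro!: continuous_intros\<close>)
    then show ?thesis by simp
  qed
  show "continuous_on Y (f x)" if "x \<in> X"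
  proof -
    have "continuous_on Y (\<lambda>y. case (x, y) of (x, y) \<Rightarrow> f x y)"
      by (rule continuous_on_compose2[OF assms]) (use that in \<open>auto intro!: continuous_intros\<close>)
    then show ?thesis by simp
  qed
qed

lemma continuous_on_slice_integral:
  fixes f :: "real \<Rightarrow> real \<Rightarrow> real"
  assumes "continuous_on ({a..b} \<times> {c..d}) (\<lambda>(x, y). f x y)"
  shows "continuous_on {a..b} (\<lambda>x. integral {c..d} (f x))" 
        "continuous_on {c..d} (\<lambda>y. integral {a..b} (\<lambda>x. f x y))"
proof -
  show "continuous_on {a..b} (\<lambda>x. integral {c..d} (f x))"
    using integral_continuous_on_param[of "{a..b}" c d f] assms by simp
  have "continuous_on ({c..d} \<times> {a..b}) (\<lambda>(y, x). f x y)"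
    by (rule continuous_on_swap_args[OF assms])
  then show "continuous_on {c..d} (\<lambda>y. integral {a..b} (\<lambda>x. f x y))"
    using integral_continuous_on_param[of "{c..d}" a b "\<lambda>y x. f x y"] by simp
qed

text \<open>The one-dimensional estimate is integrated over all horizontal and all vertical lines.
  Each direction subtracts the double integral of \<open>v\<close> once, whereas
  \<open>virtual_surplus\<close> subtracts it three times; hence the summand added back.\<close>

lemma difference_quotient_integral_rectangle:
  fixes v :: "real \<Rightarrow> real \<Rightarrow> real"
  assumes lip: "\<And>x x' y. \<bar>v x y - v x' y\<bar> \<le> \<bar>x - x'\<bar>" "\<And>x y y'. \<bar>v x y - v x y'\<bar> \<le> \<bar>y - y'\<bar>"
    and c: "0 \<le> c1" "0 \<le> c2" and b: "0 < b1" "0 < b2" and h: "h \<noteq> 0" "\<bar>h\<bar> \<le> 1"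
  obtains j where "((\<lambda>(x, y). (c1 + x) * ((v (x + h) y - v x y) / h) + (c2 + y) * ((v x (y + h) - v x y) / h))
      has_integral j) ({0..b1} \<times> {0..b2})"
    "\<bar>j - (virtual_surplus c1 c2 b1 b2 v + integral {0..b1} (\<lambda>x. integral {0..b2} (v x)))\<bar>
       \<le> (2 * (c1 + b1) * b2 + 2 * (c2 + b2) * b1) * \<bar>h\<bar>"
proof -
  note cont = separately_lipschitz_imp_continuous_on[of v, OF lip]
  have cv: "continuous_on S (\<lambda>z. v (f z) (g z))" if "continuous_on S f" "continuous_on S g" for S :: "'a::topological_space set" and f g
    using continuous_on_compose2[OF cont[of UNIV], of S "\<lambda>z. (f z, g z)"] that by (auto intro: continuous_intros)
  let ?f1 = "\<lambda>x y. (c1 + x) * ((v (x + h) y - v x y) / h)" and ?f2 = "\<lambda>x y. (c2 + y) * ((v x (y + h) - v x y) / h)"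
  have f1: "continuous_on ({0..b1} \<times> {0..b2}) (\<lambda>(x, y). ?f1 x y)"
    and f2: "continuous_on ({0..b1} \<times> {0..b2}) (\<lambda>(x, y). ?f2 x y)"
    using h by (auto simp: case_prod_beta intro!: continuous_intros cv)
  let ?j1 = "integral {0..b2} (\<lambda>y. integral {0..b1} (\<lambda>x. ?f1 x y))" and ?j2 = "integral {0..b1} (\<lambda>x. integral {0..b2} (?f2 x))"
  let ?k1 = "\<lambda>y. (c1 + b1) * v b1 y - c1 * v 0 y - integral {0..b1} (\<lambda>x. v x y)"
  let ?k2 = "\<lambda>x. (c2 + b2) * v x b2 - c2 * v x 0 - integral {0..b2} (v x)"
  note ci = integrable_continuous_interval
  note si = continuous_on_slice_integral[OF cont]
  have bound: "\<bar>integral {0..b} F - integral {0..b} G\<bar> \<le> C * b" 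
    if "continuous_on {0..b} F" "continuous_on {0..b} G" "\<And>x. \<bar>F x - G x\<bar> \<le> C" "0 < b" for F G :: "real \<Rightarrow> real" and b C
  proof -
    have "norm (integral (cbox 0 b) (\<lambda>x. F x - G x)) \<le> C * Henstock_Kurzweil_Integration.content (cbox 0 b)"
      using that order_trans[OF abs_ge_zero that(3)] by (intro integrable_bound) (auto intro!: continuous_intros ci)
    then show ?thesis using that ci[OF that(1)] ci[OF that(2)] by (simp add: integral_diff)
  qed
  have e1: "\<bar>?j1 - integral {0..b2} ?k1\<bar> \<le> 2 * (c1 + b1) * \<bar>h\<bar> * b2"
    using continuous_on_slice_integral(2)[OF f1] b h
    by (intro bound shifted_difference_quotient_integral lip c) (auto intro!: continuous_intros cv si)
  have e2: "\<bar>?j2 - integral {0..b1} ?k2\<bar> \<le> 2 * (c2 + b2) * \<bar>h\<bar> * b1"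
    using continuous_on_slice_integral(1)[OF f2] b h
    by (intro bound shifted_difference_quotient_integral lip c) (auto intro!: continuous_intros cv si)
  have e3: "integral {0..b2} ?k1 + integral {0..b1} ?k2
      = virtual_surplus c1 c2 b1 b2 v + integral {0..b1} (\<lambda>x. integral {0..b2} (v x))"
  proof -
    have "integral {0..b2} (\<lambda>y. 3 * integral {0..b1} (\<lambda>x. v x y)) = 3 * integral {0..b2} (\<lambda>y. integral {0..b1} (\<lambda>x. v x y))"
      by simp
    then show ?thesis
      unfolding virtual_surplus_def using has_integral_rectangle(2)[OF cont, of 0 b1 0 b2]
      by (subst integral_diff, (auto intro!: ci continuous_intros cv si)[2])+ simp
  qed
  have j: "((\<lambda>(x, y). ?f1 x y + ?f2 x y) has_integral (?j1 + ?j2)) ({0..b1} \<times> {0..b2})"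
    using has_integral_add[OF has_integral_rectangle(1)[OF f1] has_integral_rectangle(1)[OF f2]] has_integral_rectangle(2)[OF f1]
    by (simp only: case_prod_beta')
  have "2 * (c1 + b1) * \<bar>h\<bar> * b2 + 2 * (c2 + b2) * \<bar>h\<bar> * b1
      = (2 * (c1 + b1) * b2 + 2 * (c2 + b2) * b1) * \<bar>h\<bar>" by algebra
  then show ?thesis using that[OF j] e1 e2 e3 by linarith
qed

text \<open>Difference quotients near the boundary need values outside the rectangle. The supremum
  of all supporting planes is defined everywhere, keeps each of these planes as a support, and is
  Lipschitz because all slopes lie in \<open>[0, 1]\<close>.\<close>

lemma bounded_subgradient_extension:
  assumes sg: "bounded_subgradient b1 b2 u g1 g2" and b: "0 \<le> b1" "0 \<le> b2"
  obtains v where "\<And>x y. x \<in> {0..b1} \<Longrightarrow> y \<in> {0..b2} \<Longrightarrow> v x y = u x y"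
    "\<And>x y x' y'. x \<in> {0..b1} \<Longrightarrow> y \<in> {0..b2} \<Longrightarrow> v x y + (x' - x) * g1 x y + (y' - y) * g2 x y \<le> v x' y'"
    "\<And>x x' y. \<bar>v x y - v x' y\<bar> \<le> \<bar>x - x'\<bar>" "\<And>x y y'. \<bar>v x y - v x y'\<bar> \<le> \<bar>y - y'\<bar>"
proof -
  define R where "R = {0..b1} \<times> {0..b2}"
  define l where "l = (\<lambda>x' y' z. u (fst z) (snd z) + (x' - fst z) * g1 (fst z) (snd z) + (y' - snd z) * g2 (fst z) (snd z))"
  define v where "v = (\<lambda>x y. Sup (l x y ` R))"
  have R: "R \<noteq> {}" using b by (auto simp: R_def)
  have g: "g1 (fst z) (snd z) \<in> {0..1}" "g2 (fst z) (snd z) \<in> {0..1}" if "z \<in> R" for z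
    using sg that by (auto simp: R_def bounded_subgradient_def)
  have sub: "l x' y' z \<le> u x' y'" if "(x', y') \<in> R" "z \<in> R" for x' y' z
    using sg that by (auto simp: R_def l_def bounded_subgradient_def)
  have mul: "a * g \<le> \<bar>a\<bar>" if "g \<in> {0..1}" for a g :: real
    using that mult_right_mono[of a "\<bar>a\<bar>" g] mult_left_mono[of g 1 "\<bar>a\<bar>"] abs_ge_self[of a] by simp
  have lx: "l x y z \<le> l x' y z + \<bar>x - x'\<bar>" and ly: "l x y z \<le> l x y' z + \<bar>y - y'\<bar>" if "z \<in> R" for x x' y y' z
    using mul[OF g(1)[OF that], of "x - x'"] mul[OF g(2)[OF that], of "y - y'"] by (auto simp: l_def algebra_simps)
  have bdd: "bdd_above (l x y ` R)" for x y
  proof (rule bdd_aboveI2)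
    fix z assume z: "z \<in> R"
    have "(0, 0) \<in> R" using b by (auto simp: R_def)
    then show "l x y z \<le> u 0 0 + \<bar>x\<bar> + \<bar>y\<bar>" 
      using lx[OF z, of x y 0] ly[OF z, of 0 y 0] sub[of 0 0 z] z by simp
  qed
  have v: "l x y z \<le> v x y" if "z \<in> R" for x y z
    unfolding v_def using that bdd by (rule cSUP_upper)
  have vle: "v x y \<le> K" if "\<And>z. z \<in> R \<Longrightarrow> l x y z \<le> K" for x y K
    unfolding v_def using R that by (rule cSUP_least)
  have vx: "v x y \<le> v x' y + \<bar>x - x'\<bar>" for x x' y
    using lx v by (intro vle) (meson add_right_mono order_trans)
  have vy: "v x y \<le> v x y' + \<bar>y - y'\<bar>" for x y y'
    using ly v by (intro vle) (meson add_right_mono order_trans)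
  have eq: "v x y = u x y" if "(x, y) \<in> R" for x y
    using vle[of x y "u x y"] sub[OF that] v[OF that, of x y] by (force simp: l_def)
  show ?thesis
  proof (rule that[of v])
    show "v x y + (x' - x) * g1 x y + (y' - y) * g2 x y \<le> v x' y'" if "x \<in> {0..b1}" "y \<in> {0..b2}" for x y x' y'
      using v[of "(x, y)" x' y'] eq[of x y] that by (auto simp: R_def l_def)
    show "\<bar>v x y - v x' y\<bar> \<le> \<bar>x - x'\<bar>" for x x' y using vx[of x y x'] vx[of x' y x] by linarith
    show "\<bar>v x y - v x y'\<bar> \<le> \<bar>y - y'\<bar>" for x y y' using vy[of x y y'] vy[of x y' y] by linarith
  qed (auto simp: R_def eq)
qed

lemma virtual_surplus_cong:
  assumes "\<And>x y. x \<in> {0..b1} \<Longrightarrow> y \<in> {0..b2} \<Longrightarrow> u x y = v x y" "0 \<le> b1" "0 \<le> b2"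
  shows "virtual_surplus c1 c2 b1 b2 u = virtual_surplus c1 c2 b1 b2 v"
  unfolding virtual_surplus_def using assms
  by (intro arg_cong2[where f="(+)"] Henstock_Kurzweil_Integration.integral_cong arg_cong2[where f="(-)"] arg_cong2[where f="(*)"]) auto

text \<open>
  The subgradient is only a function, with no measurability given. It lies between the backward and
  the forward difference quotients of the extended utility, which are continuous and whose
  integrals have the same limit; this yields integrability and the value at once.
\<close>

lemma subgradient_has_integral:
  assumes sg: "bounded_subgradient b1 b2 u g1 g2" 
    and c: "0 \<le> c1" "0 \<le> c2" and b: "0 < b1" "0 < b2"
  shows "((\<lambda>(x, y). (c1 + x) * g1 x y + (c2 + y) * g2 x y - u x y) has_integral virtual_surplus c1 c2 b1 b2 u)
           ({0..b1} \<times> {0..b2})"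
proof -
  obtain v where v: "\<And>x y. x \<in> {0..b1} \<Longrightarrow> y \<in> {0..b2} \<Longrightarrow> v x y = u x y"
    "\<And>x y x' y'. x \<in> {0..b1} \<Longrightarrow> y \<in> {0..b2} \<Longrightarrow> v x y + (x' - x) * g1 x y + (y' - y) * g2 x y \<le> v x' y'"
    and lip: "\<And>x x' y. \<bar>v x y - v x' y\<bar> \<le> \<bar>x - x'\<bar>" "\<And>x y y'. \<bar>v x y - v x y'\<bar> \<le> \<bar>y - y'\<bar>"
    using bounded_subgradient_extension[OF sg] b by (metis less_imp_le)
  let ?R = "{0..b1} \<times> {0..b2}"
  define I where "I = virtual_surplus c1 c2 b1 b2 v + integral {0..b1} (\<lambda>x. integral {0..b2} (v x))"
  define C where "C = 2 * (c1 + b1) * b2 + 2 * (c2 + b2) * b1"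
  define F where "F = (\<lambda>(x, y). (c1 + x) * g1 x y + (c2 + y) * g2 x y)"
  define E where "E = (\<lambda>h (x, y). (c1 + x) * ((v (x + h) y - v x y) / h) + (c2 + y) * ((v x (y + h) - v x y) / h))"
  have C: "C > 0" using b c unfolding C_def by (intro add_pos_pos[of "_ * _"] mult_pos_pos add_nonneg_pos[of c1] add_nonneg_pos[of c2]) auto
  have E: "\<exists>j. (E h has_integral j) ?R \<and> \<bar>j - I\<bar> \<le> C * \<bar>h\<bar>" if "h \<noteq> 0" "\<bar>h\<bar> \<le> 1" for h
    by (rule difference_quotient_integral_rectangle[OF lip c b that]) (unfold E_def I_def C_def, blast)
  have upper: "F z \<le> E h z" and lower: "E (-h) z \<le> F z" if h: "h > 0" and z: "z \<in> ?R" for h z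
  proof -
    obtain x y where xy: "z = (x, y)" "x \<in> {0..b1}" "y \<in> {0..b2}" using z by auto
    have "g1 x y \<le> (v (x + h) y - v x y) / h" "g2 x y \<le> (v x (y + h) - v x y) / h"
      using v(2)[OF xy(2,3), of "x + h" y] v(2)[OF xy(2,3), of x "y + h"] h by (auto simp: field_simps)
    then show "F z \<le> E h z" unfolding xy F_def E_def prod.case using xy c by (intro add_mono mult_left_mono) auto
    have "(v (x + - h) y - v x y) / - h \<le> g1 x y" "(v x (y + - h) - v x y) / - h \<le> g2 x y"
      using v(2)[OF xy(2,3), of "x + - h" y] v(2)[OF xy(2,3), of x "y + - h"] h by (auto simp: field_simps)
    then show "E (-h) z \<le> F z" unfolding xy F_def E_def prod.case 
      using xy c by (intro add_mono mult_left_mono) auto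
  qed
  have sandwich: "\<exists>i j. (E (-h) has_integral i) ?R \<and> (E h has_integral j) ?R \<and> \<bar>i - I\<bar> \<le> C * h \<and> \<bar>j - I\<bar> \<le> C * h" 
    if "0 < h" "h \<le> 1" for h using E[of h] E[of "-h"] that by auto
  \<comment> \<open>The \<open>3\<close> keeps each of the two errors strictly below
    \<open>e / 2\<close>, as \<open>integrable_straddle\<close> requires a strict
    inequality.\<close>
  define H where "H = (\<lambda>e. min 1 (e / (3 * C)))"
  have H: "0 < H e" "H e \<le> 1" "C * H e < e / 2" if "0 < e" for e
  proof -
    show "0 < H e" "H e \<le> 1" using that C by (auto simp: H_def)
    have "C * H e \<le> C * (e / (3 * C))" unfolding H_def using C by (intro mult_left_mono) auto
    also have "\<dots> = e / 3" using C by simp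
    finally show "C * H e < e / 2" using that by simp
  qed
  have Fint: "F integrable_on ?R"
  proof (rule integrable_straddle)
    fix e :: real assume e: "e > 0"
    from sandwich[OF H(1,2)[OF e]] obtain i j where "(E (- H e) has_integral i) ?R" "(E (H e) has_integral j) ?R"
      "\<bar>i - I\<bar> \<le> C * H e" "\<bar>j - I\<bar> \<le> C * H e" by blast
    then show "\<exists>g h i j. (g has_integral i) ?R \<and> (h has_integral j) ?R \<and> \<bar>i - j\<bar> < e \<and> (\<forall>x\<in>?R. g x \<le> F x \<and> F x \<le> h x)"
      using H[OF e] upper lower
      by - (rule exI[of _ "E (- H e)"], rule exI[of _ "E (H e)"], rule exI[of _ i], rule exI[of _ j], force)
  qed
  have "\<bar>integral ?R F - I\<bar> \<le> e" if e: "e > 0" for e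
  proof -
    from sandwich[OF H(1,2)[OF e]] obtain i j where *: "(E (- H e) has_integral i) ?R" "(E (H e) has_integral j) ?R"
      "\<bar>i - I\<bar> \<le> C * H e" "\<bar>j - I\<bar> \<le> C * H e" by blast
    have "i \<le> integral ?R F" "integral ?R F \<le> j"
      using has_integral_le[OF *(1) integrable_integral[OF Fint]] has_integral_le[OF integrable_integral[OF Fint] *(2)]
        upper lower H(1)[OF e] by auto
    then show ?thesis using * H(3)[OF e] e by linarith
  qed
  then have "\<bar>integral ?R F - I\<bar> \<le> 0" by (rule field_le_epsilon) simp
  then have "integral ?R F = I" by simp
  then have F: "(F has_integral I) ?R" using Fint by (simp add: has_integral_iff)
  have "((\<lambda>z. F z - (case z of (x, y) \<Rightarrow> v x y)) has_integral (I - integral {0..b1} (\<lambda>x. integral {0..b2} (v x)))) ?R"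
    by (intro has_integral_diff F has_integral_rectangle separately_lipschitz_imp_continuous_on lip)
  moreover have "I - integral {0..b1} (\<lambda>x. integral {0..b2} (v x)) = virtual_surplus c1 c2 b1 b2 v"
    unfolding I_def by simp
  ultimately have D: "((\<lambda>z. F z - (case z of (x, y) \<Rightarrow> v x y)) has_integral virtual_surplus c1 c2 b1 b2 v) ?R"
    by simp
  have "((\<lambda>(x, y). (c1 + x) * g1 x y + (c2 + y) * g2 x y - u x y) has_integral virtual_surplus c1 c2 b1 b2 v) ?R"
    by (rule has_integral_eq[OF _ D]) (auto simp: F_def v)
  moreover have "virtual_surplus c1 c2 b1 b2 v = virtual_surplus c1 c2 b1 b2 u"
    using v(1) b by (intro virtual_surplus_cong) auto
  ultimately show ?thesis by simp
qed

section \<open>Mechanisms in coordinates relative to the lower left corner\<close>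

definition shifted_utility :: "real \<Rightarrow> real \<Rightarrow> (valuation \<Rightarrow> alloc) \<Rightarrow> (valuation \<Rightarrow> real) \<Rightarrow> real \<Rightarrow> real \<Rightarrow> real" where
  "shifted_utility c1 c2 q t x y = (c1 + x, c2 + y) \<bullet> q (c1 + x, c2 + y) - t (c1 + x, c2 + y)"

text \<open>Incentive compatibility for a fixed report is the subgradient inequality at that report,
  with the allocation as slope.\<close>

lemma bounded_subgradient_shifted_utility:
  assumes "mechanism ({c1..c1 + b1} \<times> {c2..c2 + b2}) q t" 
    "incentive_compatible ({c1..c1 + b1} \<times> {c2..c2 + b2}) q t"
  shows "bounded_subgradient b1 b2 (shifted_utility c1 c2 q t)
           (\<lambda>x y. fst (q (c1 + x, c2 + y))) (\<lambda>x y. snd (q (c1 + x, c2 + y)))"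
  unfolding bounded_subgradient_def
proof (intro ballI conjI)
  fix x y assume xy: "x \<in> {0..b1}" "y \<in> {0..b2}"
  then have D: "(c1 + x, c2 + y) \<in> {c1..c1 + b1} \<times> {c2..c2 + b2}" by auto
  then have "q (c1 + x, c2 + y) \<in> {0..1} \<times> {0..1}" using assms unfolding mechanism_def by blast
  then show "fst (q (c1 + x, c2 + y)) \<in> {0..1}" "snd (q (c1 + x, c2 + y)) \<in> {0..1}" by (auto simp: mem_Times_iff)
  fix x' y' assume "x' \<in> {0..b1}" "y' \<in> {0..b2}"
  then have "(c1 + x', c2 + y') \<in> {c1..c1 + b1} \<times> {c2..c2 + b2}" by auto
  then have "(c1 + x', c2 + y') \<bullet> q (c1 + x, c2 + y) - t (c1 + x, c2 + y) 
      \<le> (c1 + x', c2 + y') \<bullet> q (c1 + x', c2 + y') - t (c1 + x', c2 + y')"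
    using assms D unfolding incentive_compatible_def by blast
  then show "shifted_utility c1 c2 q t x y + (x' - x) * fst (q (c1 + x, c2 + y)) + (y' - y) * snd (q (c1 + x, c2 + y))
     \<le> shifted_utility c1 c2 q t x' y'"
    by (simp add: shifted_utility_def inner_prod_def algebra_simps)
qed

text \<open>A nonnegative gauge integrable function is Lebesgue integrable, so the measurability of
  the payment comes out of \<open>has_integral\<close> and need not be assumed.\<close>

lemma revenue_eq_integral:
  assumes t: "(t has_integral I) ({a..b} \<times> {c..d})" and nonneg: "\<And>z. z \<in> {a..b} \<times> {c..d} \<Longrightarrow> 0 \<le> t z"
    and "a < b" "c < d"
  shows "revenue ({a..b} \<times> {c..d}) t = I / ((b - a) * (d - c))"
proof -
  let ?D = "{a..b} \<times> {c..d}" 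
  have D: "?D = cbox (a, c) (b, d)" by (simp add: cbox_Pair_eq)
  have Dm: "?D \<in> sets lebesgue" unfolding D by simp
  have m: "measure (lebesgue_on ?D) ?D = (b - a) * (d - c)" 
    using assms unfolding D by (simp add: measure_restrict_space content_Pair)
  have e: "emeasure (lebesgue_on ?D) ?D = ennreal ((b - a) * (d - c))"
    using assms unfolding D
    by (simp add: emeasure_restrict_space emeasure_lborel_cbox_eq Basis_prod_def)
  have abs: "t absolutely_integrable_on ?D"
    using t nonneg by (intro nonnegative_absolutely_integrable_1) auto
  then have int: "integrable (lebesgue_on ?D) t"
    using integrable_restrict_space[of ?D lebesgue t] Dm by (simp add: set_integrable_def)
  have pos: "(b - a) * (d - c) > 0" using assms by simp
  have dens: "uniform_measure (lebesgue_on ?D) ?D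
      = density (lebesgue_on ?D) (\<lambda>z. ennreal (indicator ?D z / ((b - a) * (d - c))))"
    unfolding uniform_measure_def e using pos
    by (intro arg_cong2[where f=density] refl ext) (auto simp: indicator_def divide_ennreal ennreal_1[symmetric] simp del: ennreal_1)
  have "revenue ?D t = (LINT z|lebesgue_on ?D. (indicator ?D z / ((b - a) * (d - c))) *\<^sub>R t z)"
    unfolding revenue_def dens
  proof (rule integral_density)
    show "(\<lambda>z. indicat_real ?D z / ((b - a) * (d - c))) \<in> borel_measurable (lebesgue_on ?D)"
      by (subst measurable_cong[where g = "\<lambda>_. 1 / ((b - a) * (d - c))"]) (auto simp: indicator_def)
  qed (use pos int in auto)
  also have "\<dots> = (LINT z|lebesgue_on ?D. t z / ((b - a) * (d - c)))"
    by (intro Bochner_Integration.integral_cong) (auto simp: indicator_def)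
  also have "\<dots> = integral\<^sup>L (lebesgue_on ?D) t / ((b - a) * (d - c))" by simp
  also have "integral\<^sup>L (lebesgue_on ?D) t = I"
    using lebesgue_integral_eq_integral[OF int Dm] t by (simp add: integral_unique)
  finally show ?thesis .
qed

text \<open>The integrand of \<open>subgradient_has_integral\<close>, valuation times allocation
  minus utility, is the payment.\<close>

lemma revenue_eq_virtual_surplus:
  assumes m: "mechanism ({c1..c1 + b1} \<times> {c2..c2 + b2}) q t" 
    and ic: "incentive_compatible ({c1..c1 + b1} \<times> {c2..c2 + b2}) q t"
    and c: "0 \<le> c1" "0 \<le> c2" and b: "0 < b1" "0 < b2"
  shows "revenue ({c1..c1 + b1} \<times> {c2..c2 + b2}) t = virtual_surplus c1 c2 b1 b2 (shifted_utility c1 c2 q t) / (b1 * b2)"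
proof -
  let ?R = "{0..b1} \<times> {0..b2}" and ?V = "virtual_surplus c1 c2 b1 b2 (shifted_utility c1 c2 q t)"
  have "((t \<circ> (+) (c1, c2)) has_integral ?V) ?R"
    by (rule has_integral_eq[OF _ subgradient_has_integral[OF bounded_subgradient_shifted_utility[OF m ic] c b]])
      (auto simp: shifted_utility_def inner_prod_def)
  then have "((t \<circ> (+) (c1, c2)) has_integral ?V) (cbox (0, 0) (b1, b2))" by (simp add: cbox_Pair_eq)
  then have "(t has_integral ?V) (cbox ((0, 0) + (c1, c2)) ((b1, b2) + (c1, c2)))"
    by (simp only: has_integral_shift_cbox_iff)
  then have "(t has_integral ?V) ({c1..c1 + b1} \<times> {c2..c2 + b2})"
    by (simp add: cbox_Pair_eq add.commute)
  from revenue_eq_integral[OF this] show ?thesis using m b by (auto simp: mechanism_def)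
qed

text \<open>The slope bounds are the subgradient inequality at the farther point, tested at the
  nearer one. Convexity is the weighted sum of the inequalities at the intermediate point.\<close>

lemma
  assumes sg: "bounded_subgradient b1 b2 u g1 g2"
  shows bounded_subgradient_slope_x: "0 \<le> x \<Longrightarrow> x \<le> x' \<Longrightarrow> x' \<le> b1 \<Longrightarrow> y \<in> {0..b2} \<Longrightarrow> u x' y \<le> u x y + (x' - x)"
    and bounded_subgradient_slope_y: "0 \<le> y \<Longrightarrow> y \<le> y' \<Longrightarrow> y' \<le> b2 \<Longrightarrow> x \<in> {0..b1} \<Longrightarrow> u x y' \<le> u x y + (y' - y)"
    and bounded_subgradient_convex: "x \<in> {0..b1} \<Longrightarrow> convex_on {0..b2} (u x)"
    and bounded_subgradient_continuous: "0 \<le> b1 \<Longrightarrow> 0 \<le> b2 \<Longrightarrow> continuous_on ({0..b1} \<times> {0..b2}) (\<lambda>(x, y). u x y)"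
proof -
  have g: "g1 x y \<in> {0..1}" "g2 x y \<in> {0..1}" and
    sub: "\<And>x' y'. x' \<in> {0..b1} \<Longrightarrow> y' \<in> {0..b2} \<Longrightarrow> u x y + (x' - x) * g1 x y + (y' - y) * g2 x y \<le> u x' y'" 
    if "x \<in> {0..b1}" "y \<in> {0..b2}" for x y
    using sg that unfolding bounded_subgradient_def by blast+
  show "u x' y \<le> u x y + (x' - x)" if "0 \<le> x" "x \<le> x'" "x' \<le> b1" "y \<in> {0..b2}"
    using sub[of x' y x y] g(1)[of x' y] that mult_left_mono[of "g1 x' y" 1 "x' - x"] by (auto simp: algebra_simps)
  show "u x y' \<le> u x y + (y' - y)" if "0 \<le> y" "y \<le> y'" "y' \<le> b2" "x \<in> {0..b1}"
    using sub[of x y' x y] g(2)[of x y'] that mult_left_mono[of "g2 x y'" 1 "y' - y"] by (auto simp: algebra_simps)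
  show "convex_on {0..b2} (u x)" if x: "x \<in> {0..b1}"
  proof (rule convex_onI)
    fix \<theta> y y' :: real assume \<theta>: "0 < \<theta>" "\<theta> < 1" and y: "y \<in> {0..b2}" "y' \<in> {0..b2}"
    let ?m = "(1 - \<theta>) *\<^sub>R y + \<theta> *\<^sub>R y'"
    have m: "?m \<in> {0..b2}" using convex_real_interval(5)[of 0 b2] y \<theta> unfolding convex_alt by auto
    have "(1 - \<theta>) * (u x ?m + (y - ?m) * g2 x ?m) + \<theta> * (u x ?m + (y' - ?m) * g2 x ?m) \<le> (1 - \<theta>) * u x y + \<theta> * u x y'"
      using sub[OF x m x y(1)] sub[OF x m x y(2)] \<theta> by (intro add_mono mult_left_mono) auto
    then show "u x ?m \<le> (1 - \<theta>) * u x y + \<theta> * u x y'" by (simp add: algebra_simps)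
  qed simp
  show "continuous_on ({0..b1} \<times> {0..b2}) (\<lambda>(x, y). u x y)" if b: "0 \<le> b1" "0 \<le> b2"
  proof -
    obtain v where v: "\<And>x y. x \<in> {0..b1} \<Longrightarrow> y \<in> {0..b2} \<Longrightarrow> v x y = u x y"
      and lip: "\<And>x x' y. \<bar>v x y - v x' y\<bar> \<le> \<bar>x - x'\<bar>" "\<And>x y y'. \<bar>v x y - v x y'\<bar> \<le> \<bar>y - y'\<bar>"
      using bounded_subgradient_extension[OF sg b] by metis
    show ?thesis
      by (rule continuous_on_eq[OF separately_lipschitz_imp_continuous_on[OF lip]]) (auto simp: v)
  qed
qed

subsection \<open>Transporting the mass\<close>

lemma antimono_integral_bounds:
  fixes f :: "real \<Rightarrow> real"
  assumes "continuous_on {a..b} f" "a \<le> b" "\<And>x x'. a \<le> x \<Longrightarrow> x \<le> x' \<Longrightarrow> x' \<le> b \<Longrightarrow> f x' \<le> f x"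
  shows "(b - a) * f b \<le> integral {a..b} f" "integral {a..b} f \<le> (b - a) * f a"
proof -
  have f: "f integrable_on {a..b}" using assms(1) by (rule integrable_continuous_interval)
  have "integral {a..b} (\<lambda>_. f b) \<le> integral {a..b} f" "integral {a..b} f \<le> integral {a..b} (\<lambda>_. f a)"
    using assms by (intro integral_le f integrable_const_ivl; simp)+
  moreover have "integral {a..b} (\<lambda>_. K) = (b - a) * K" for K :: real using assms(2) by simp
  ultimately show "(b - a) * f b \<le> integral {a..b} f" "integral {a..b} f \<le> (b - a) * f a" by metis+
qed

lemma integral_split_continuous:
  fixes f :: "real \<Rightarrow> real"
  assumes "continuous_on {a..b} f" "a \<le> c" "c \<le> b"
  shows "integral {a..b} f = integral {a..c} f + integral {c..b} f"
  using Henstock_Kurzweil_Integration.integral_combine[OF assms(2,3) integrable_continuous_interval[OF assms(1)]] by simp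

text \<open>For heights that meet the region without sale, of width \<open>w\<close> there. The
  right edge moves left onto the average over \<open>[p, b]\<close>; the interior beyond
  \<open>w\<close> moves right onto it, as \<open>g\<close> on \<open>[w, p]\<close> is at least
  that average; the left edge and \<open>[0, w]\<close> put negative mass on nonnegative values and
  are dropped. There remains \<open>c + b - 3 * (b - w)\<close>.\<close>

lemma line_surplus_le_average:
  fixes g :: "real \<Rightarrow> real"
  assumes g: "continuous_on {0..b} g" and c: "0 \<le> c" and w: "0 \<le> w" "w \<le> p" "p < b"
    and nonneg: "\<And>x. 0 \<le> x \<Longrightarrow> x \<le> w \<Longrightarrow> 0 \<le> g x"
    and anti: "\<And>x x'. w \<le> x \<Longrightarrow> x \<le> x' \<Longrightarrow> x' \<le> b \<Longrightarrow> g x' \<le> g x"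
  shows "(c + b) * g b - c * g 0 - 3 * integral {0..b} g \<le> (c - 2 * b + 3 * w) * (integral {p..b} g / (b - p))"
proof -
  define A where "A = integral {p..b} g / (b - p)"
  have cont: "continuous_on {u..v} g" if "0 \<le> u" "v \<le> b" for u v
    using g by (rule continuous_on_subset) (use that in auto)
  have p: "(b - p) * g b \<le> integral {p..b} g" "integral {p..b} g \<le> (b - p) * g p"
    using w by (auto intro!: antimono_integral_bounds cont anti)
  have A: "integral {p..b} g = (b - p) * A" "g b \<le> A" "A \<le> g p"
    using p w by (auto simp: A_def field_simps)
  have "(p - w) * g p \<le> integral {w..p} g" using w by (intro antimono_integral_bounds cont anti) auto
  moreover have "(p - w) * A \<le> (p - w) * g p" using w A by (intro mult_left_mono) auto
  moreover have "0 \<le> integral {0..w} g"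
    using w nonneg by (intro integral_nonneg integrable_continuous_interval cont) auto
  moreover have "integral {0..b} g = integral {0..w} g + (integral {w..p} g + integral {p..b} g)"
    using w integral_split_continuous[OF cont[of 0 b], of w] integral_split_continuous[OF cont[of w b], of p] by simp
  ultimately have "(b - w) * A \<le> integral {0..b} g" using A(1) by (simp add: algebra_simps)
  moreover have "(c + b) * g b \<le> (c + b) * A" using A c w by (intro mult_left_mono) auto
  moreover have "0 \<le> c * g 0" using nonneg[of 0] c w by simp
  ultimately show ?thesis unfolding A_def[symmetric] by (simp add: algebra_simps)
qed

text \<open>Above the region without sale the sign of \<open>g\<close> is unknown, so the left edge
  cannot be dropped. But \<open>g\<close> now decreases on the whole line, so this mass too moves
  right onto the average, leaving \<open>c + b - c - 3 * b\<close>.\<close>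

lemma full_line_surplus_le_average:
  fixes g :: "real \<Rightarrow> real"
  assumes g: "continuous_on {0..b} g" and c: "0 \<le> c" and p: "0 \<le> p" "p < b"
    and anti: "\<And>x x'. 0 \<le> x \<Longrightarrow> x \<le> x' \<Longrightarrow> x' \<le> b \<Longrightarrow> g x' \<le> g x"
  shows "(c + b) * g b - c * g 0 - 3 * integral {0..b} g \<le> - 2 * b * (integral {p..b} g / (b - p))"
proof -
  define A where "A = integral {p..b} g / (b - p)"
  have cont: "continuous_on {u..v} g" if "0 \<le> u" "v \<le> b" for u v
    using g by (rule continuous_on_subset) (use that in auto)
  have pb: "(b - p) * g b \<le> integral {p..b} g" "integral {p..b} g \<le> (b - p) * g p"
    using p by (auto intro!: antimono_integral_bounds cont anti)
  have A: "integral {p..b} g = (b - p) * A" "g b \<le> A" "A \<le> g p"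
    using pb p by (auto simp: A_def field_simps)
  have "(p - 0) * g p \<le> integral {0..p} g" using p by (intro antimono_integral_bounds cont anti) auto
  moreover have "p * A \<le> p * g p" using p A by (intro mult_left_mono) auto
  moreover have "integral {0..b} g = integral {0..p} g + integral {p..b} g"
    using p integral_split_continuous[OF cont[of 0 b], of p] by simp
  ultimately have "b * A \<le> integral {0..b} g" using A(1) by (simp add: algebra_simps)
  moreover have "(c + b) * g b \<le> (c + b) * A" using A c p by (intro mult_left_mono) auto
  moreover have "c * A \<le> c * g 0" using A anti[of 0 p] c p by (intro mult_left_mono) auto
  ultimately show ?thesis unfolding A_def[symmetric] by (simp add: algebra_simps)
qed

text \<open>The densities \<open>k\<close> and \<open>l\<close> are what the top edge contributes to
  a line. Summation by parts: by \<open>balance\<close> the total mass is zero, and the mass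
  accumulated from the left is \<open>- c\<close> after the edge, \<open>- (c + (3 - k) * p)\<close>
  after \<open>[0, p]\<close> and \<open>- (c + b)\<close> before the right edge, never positive;
  \<open>g\<close> decreases.\<close>

lemma balanced_line_surplus_nonpos:
  fixes g :: "real \<Rightarrow> real"
  assumes g: "continuous_on {0..b} g" and c: "0 \<le> c" and p: "0 \<le> p" "p < b"
    and anti: "\<And>x x'. 0 \<le> x \<Longrightarrow> x \<le> x' \<Longrightarrow> x' \<le> b \<Longrightarrow> g x' \<le> g x"
    and balance: "b + (k - 3) * p + (l - 3) * (b - p) = 0" and left: "0 \<le> c + (3 - k) * p"
  shows "(c + b) * g b - c * g 0 - 3 * integral {0..b} g + k * integral {0..p} g + l * integral {p..b} g \<le> 0"
proof -
  have cont: "continuous_on {u..v} g" if "0 \<le> u" "v \<le> b" for u v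
    using g by (rule continuous_on_subset) (use that in auto)
  have pb: "(b - p) * g b \<le> integral {p..b} g" "integral {p..b} g \<le> (b - p) * g p"
    using p by (auto intro!: antimono_integral_bounds cont anti)
  have p0: "(p - 0) * g p \<le> integral {0..p} g" "integral {0..p} g \<le> (p - 0) * g 0"
    using p by (auto intro!: antimono_integral_bounds[where a = 0, simplified] cont anti)
  \<comment> \<open>For \<open>p = 0\<close> the quotient would be \<open>0\<close>; the value
    \<open>g 0\<close> keeps the average between \<open>g p\<close> and \<open>g 0\<close>.\<close>
  define A1 where "A1 = (if p = 0 then g 0 else integral {0..p} g / p)"
  define A2 where "A2 = integral {p..b} g / (b - p)"
  have A1: "integral {0..p} g = p * A1" "g p \<le> A1" "A1 \<le> g 0"
    using p0 p by (auto simp: A1_def field_simps)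
  have A2: "integral {p..b} g = (b - p) * A2" "g b \<le> A2" "A2 \<le> g p"
    using pb p by (auto simp: A2_def field_simps)
  have "0 \<le> c * (g 0 - A1)" "0 \<le> (c + (3 - k) * p) * (A1 - A2)" "0 \<le> (c + b) * (A2 - g b)"
    using c left p A1 A2 by (auto intro!: mult_nonneg_nonneg)
  moreover have "integral {0..b} g = integral {0..p} g + integral {p..b} g"
    using p integral_split_continuous[OF cont[of 0 b], of p] by simp
  moreover have "(b + (k - 3) * p + (l - 3) * (b - p)) * A2 = 0" using balance by simp
  ultimately show ?thesis unfolding A1 A2 by (simp add: algebra_simps)
qed

text \<open>
  Nothing is sold in the triangle \<open>x \<le> a * (s - y)\<close>. The number \<open>w\<close> is the density, over
  \<open>p \<le> x\<close>, of the mass of the top edge that is not needed above \<open>n\<close> and is moved down to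
  height \<open>n\<close>.
\<close>

lemma virtual_surplus_le_vertical:
  fixes d :: "real \<Rightarrow> real \<Rightarrow> real"
  assumes cont: "continuous_on ({0..b1} \<times> {0..b2}) (\<lambda>(x, y). d x y)"
    and c: "0 \<le> c1" "0 \<le> c2" and a: "0 \<le> a" and s: "0 \<le> s" "s \<le> n" "n < b2"
    and p: "p = a * s" "p < b1" and w: "0 \<le> w"
    and balance: "(c2 + b2) * p + (c2 + b2 - w) * (b1 - p) = 2 * b1 * (b2 - n)"
    and left: "(c2 + b2) * p \<le> (c1 + 3 * p) * (b2 - n)"
    and nonneg: "\<And>x y. 0 \<le> x \<Longrightarrow> 0 \<le> y \<Longrightarrow> y \<le> s \<Longrightarrow> x \<le> a * (s - y) \<Longrightarrow> 0 \<le> d x y"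
    and anti_x: "\<And>x x' y. 0 \<le> y \<Longrightarrow> y \<le> b2 \<Longrightarrow> 0 \<le> x \<Longrightarrow> a * (s - y) \<le> x \<Longrightarrow> x \<le> x' \<Longrightarrow> x' \<le> b1 \<Longrightarrow> d x' y \<le> d x y"
    and anti_y: "\<And>x y y'. 0 \<le> x \<Longrightarrow> x \<le> b1 \<Longrightarrow> n \<le> y \<Longrightarrow> y \<le> y' \<Longrightarrow> y' \<le> b2 \<Longrightarrow> d x y' \<le> d x y"
  defines "\<psi> \<equiv> \<lambda>y. integral {p..b1} (\<lambda>x. d x y) / (b1 - p)"
  shows "virtual_surplus c1 c2 b1 b2 d
     \<le> integral {0..s} (\<lambda>y. (c1 - 2 * b1 + 3 * (a * (s - y))) * \<psi> y) - 2 * b1 * integral {s..n} \<psi>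
       - c2 * (b1 - p) * \<psi> 0 + w * (b1 - p) * \<psi> n"
proof -
  have p0: "0 \<le> p" using p(1) a s by simp
  have ints: "continuous_on ({u..v} \<times> {u'..v'}) (\<lambda>(x, y). d x y)" if "0 \<le> u" "v \<le> b1" "0 \<le> u'" "v' \<le> b2" for u v u' v'
    using cont by (rule continuous_on_subset) (use that in auto)
  have cx: "continuous_on {u..v} (\<lambda>x. d x y)" if "0 \<le> u" "v \<le> b1" "0 \<le> y" "y \<le> b2" for u v y
    using continuous_on_slices(1)[OF ints[of u v 0 b2]] that by auto
  have cy: "continuous_on {u..v} (\<lambda>y. d x y)" if "0 \<le> u" "v \<le> b2" "0 \<le> x" "x \<le> b1" for u v x
    using continuous_on_slices(2)[OF ints[of 0 b1 u v]] that by auto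
  have cix: "continuous_on {u'..v'} (\<lambda>y. integral {u..v} (\<lambda>x. d x y))" 
   and ciy: "continuous_on {u..v} (\<lambda>x. integral {u'..v'} (\<lambda>y. d x y))" if "0 \<le> u" "v \<le> b1" "0 \<le> u'" "v' \<le> b2" for u v u' v'
    using continuous_on_slice_integral[OF ints[OF that]] by auto
  have c\<psi>: "continuous_on {u..v} \<psi>" if "0 \<le> u" "v \<le> b2" for u v
    unfolding \<psi>_def using that p p0 by (auto intro!: continuous_intros cix)
  note ic = integrable_continuous_interval
  define S where "S = (\<lambda>y. (c1 + b1) * d b1 y - c1 * d 0 y - 3 * integral {0..b1} (\<lambda>x. d x y))"
  have cS: "continuous_on {u..v} S" if "0 \<le> u" "v \<le> b2" for u v
    unfolding S_def using that p p0 by (auto intro!: continuous_intros cix cy)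
  define N where "N = b2 - n"
  have N: "N > 0" using s by (simp add: N_def)
  \<comment> \<open>The top edge spread uniformly over the heights \<open>[n, b2]\<close>, without
    the part \<open>w\<close> over \<open>[p, b1]\<close>. Divided by \<open>N\<close>, the
    hypotheses \<open>balance\<close> and \<open>left\<close> become those of
    \<open>balanced_line_surplus_nonpos\<close>.\<close>
  define k where "k = (c2 + b2) / N"
  define l where "l = (c2 + b2 - w) / N"
  have kN: "k * N = c2 + b2" and lN: "l * N = c2 + b2 - w" using N by (auto simp: k_def l_def)
  have b1: "0 < b1" using p0 p by simp
  have wp: "a * (s - y) \<le> p" if "0 \<le> y" for y
    unfolding p(1) using that a by (intro mult_left_mono) auto
  have S1: "integral {0..s} S \<le> integral {0..s} (\<lambda>y. (c1 - 2 * b1 + 3 * (a * (s - y))) * \<psi> y)"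
  proof (rule integral_le)
    fix y assume y: "y \<in> {0..s}"
    then have "0 \<le> a * (s - y)" using a by simp
    then show "S y \<le> (c1 - 2 * b1 + 3 * (a * (s - y))) * \<psi> y"
      unfolding S_def \<psi>_def using y s wp[of y] p c
      by (intro line_surplus_le_average cx nonneg anti_x) auto
  qed (use s in \<open>auto intro!: ic continuous_intros cS c\<psi>\<close>)
  have S2: "integral {s..n} S \<le> integral {s..n} (\<lambda>y. - 2 * b1 * \<psi> y)"
  proof (rule integral_le)
    fix y assume y: "y \<in> {s..n}"
    then have "a * (s - y) \<le> 0" using a by (simp add: mult_nonneg_nonpos)
    then show "S y \<le> - 2 * b1 * \<psi> y"
      unfolding S_def \<psi>_def using y s p0 p c
      by (intro full_line_surplus_le_average cx anti_x) auto
  qed (use s in \<open>auto intro!: ic continuous_intros cS c\<psi>\<close>)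
  have S3: "integral {n..b2} S \<le> integral {n..b2} (\<lambda>y. - k * integral {0..p} (\<lambda>x. d x y) - l * integral {p..b1} (\<lambda>x. d x y))"
  proof (rule integral_le)
    fix y assume y: "y \<in> {n..b2}"
    then have neg: "a * (s - y) \<le> 0" using a s by (simp add: mult_nonneg_nonpos)
    have "N * (b1 + (k - 3) * p + (l - 3) * (b1 - p)) = (k * N) * p + (l * N) * (b1 - p) - 2 * b1 * N"
      by (simp add: algebra_simps)
    also have "\<dots> = 0" unfolding kN lN using balance by (simp add: N_def)
    finally have bal: "b1 + (k - 3) * p + (l - 3) * (b1 - p) = 0" using N by simp
    have "N * (c1 + (3 - k) * p) = (c1 + 3 * p) * N - (k * N) * p" by (simp add: algebra_simps)
    also have "\<dots> \<ge> 0" unfolding kN using left by (simp add: N_def)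
    finally have left': "0 \<le> c1 + (3 - k) * p" using N by (simp add: zero_le_mult_iff)
    have "(c1 + b1) * d b1 y - c1 * d 0 y - 3 * integral {0..b1} (\<lambda>x. d x y) + k * integral {0..p} (\<lambda>x. d x y) + l * integral {p..b1} (\<lambda>x. d x y) \<le> 0"
      using y s neg c p p0 bal left' by (intro balanced_line_surplus_nonpos cx anti_x) auto
    then show "S y \<le> - k * integral {0..p} (\<lambda>x. d x y) - l * integral {p..b1} (\<lambda>x. d x y)"
      unfolding S_def by simp
  qed (use s p p0 in \<open>auto intro!: ic continuous_intros cS cix\<close>)
  define M where "M = (\<lambda>x. integral {n..b2} (\<lambda>y. d x y))"
  have cM: "continuous_on {u..v} M" if "0 \<le> u" "v \<le> b1" for u v
    unfolding M_def using that s by (auto intro!: ciy)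
  have swap1: "integral {n..b2} (\<lambda>y. integral {u..v} (\<lambda>x. d x y)) = integral {u..v} M" if "0 \<le> u" "v \<le> b1" for u v
    unfolding M_def using has_integral_rectangle(2)[OF ints[of u v n b2]] that s by simp
  have S3': "integral {n..b2} S \<le> - k * integral {0..p} M - l * integral {p..b1} M"
  proof -
    have "integral {n..b2} (\<lambda>y. - k * integral {0..p} (\<lambda>x. d x y) - l * integral {p..b1} (\<lambda>x. d x y))
       = - k * integral {n..b2} (\<lambda>y. integral {0..p} (\<lambda>x. d x y)) - l * integral {n..b2} (\<lambda>y. integral {p..b1} (\<lambda>x. d x y))"
      using s p p0 by (subst integral_diff) (auto intro!: ic continuous_intros cix)
    then show ?thesis using S3 swap1[of 0 p] swap1[of p b1] p p0 by simp
  qed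
  have M: "N * d x b2 \<le> M x" "M x \<le> N * d x n" if "0 \<le> x" "x \<le> b1" for x
    unfolding N_def M_def using that s by (auto intro!: antimono_integral_bounds cy anti_y)
  have cb: "0 \<le> c2 + b2" using c s by simp
  have T1: "integral {0..p} (\<lambda>x. (c2 + b2) * d x b2) \<le> integral {0..p} (\<lambda>x. k * M x)"
  proof (rule integral_le)
    fix x assume x: "x \<in> {0..p}"
    have k: "0 \<le> k" using cb N by (simp add: k_def)
    have "(c2 + b2) * d x b2 = k * (N * d x b2)" by (simp add: kN[symmetric])
    also have "\<dots> \<le> k * M x" using M(1)[of x] x p k by (intro mult_left_mono) auto
    finally show "(c2 + b2) * d x b2 \<le> k * M x" .
  qed (use s p p0 in \<open>auto intro!: ic continuous_intros cM cx\<close>)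
  \<comment> \<open>The part \<open>w\<close> of the top mass goes down in two moves: from
    \<open>b2\<close> to the average over \<open>[n, b2]\<close>, and from there to
    \<open>n\<close>.\<close>
  have T2: "integral {p..b1} (\<lambda>x. (c2 + b2) * d x b2) \<le> integral {p..b1} (\<lambda>x. l * M x + w * d x n)"
  proof (rule integral_le)
    fix x assume x: "x \<in> {p..b1}"
    have "(c2 + b2) * (N * d x b2) \<le> (c2 + b2) * M x" "w * M x \<le> w * (N * d x n)"
      using M[of x] x p0 cb w by (auto intro!: mult_left_mono)
    then have "N * ((c2 + b2) * d x b2) \<le> (c2 + b2 - w) * M x + w * (N * d x n)" by (simp add: algebra_simps)
    also have "\<dots> = N * (l * M x + w * d x n)" unfolding lN[symmetric] by (simp add: algebra_simps)
    finally show "(c2 + b2) * d x b2 \<le> l * M x + w * d x n" using N by simp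
  qed (use s p p0 in \<open>auto intro!: ic continuous_intros cM cx\<close>)
  have \<psi>: "integral {p..b1} (\<lambda>x. d x y) = (b1 - p) * \<psi> y" for y using p by (simp add: \<psi>_def)
  have T2': "integral {p..b1} (\<lambda>x. (c2 + b2) * d x b2) \<le> l * integral {p..b1} M + w * ((b1 - p) * \<psi> n)"
  proof -
    have "integral {p..b1} (\<lambda>x. l * M x + w * d x n) = l * integral {p..b1} M + w * integral {p..b1} (\<lambda>x. d x n)"
      using s p p0 by (subst integral_add) (auto intro!: ic continuous_intros cM cx)
    then show ?thesis using T2 \<psi> by simp
  qed
  have B: "(b1 - p) * \<psi> 0 \<le> integral {0..b1} (\<lambda>x. d x 0)"
  proof -
    have "0 \<le> integral {0..p} (\<lambda>x. d x 0)"
      using s p p0 by (intro integral_nonneg ic cx nonneg) auto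
    then show ?thesis using integral_split_continuous[OF cx[of 0 b1 0], of p] s p p0 \<psi>[of 0] by simp
  qed
  have "virtual_surplus c1 c2 b1 b2 d
     = integral {0..b2} S + (integral {0..b1} (\<lambda>x. (c2 + b2) * d x b2) - c2 * integral {0..b1} (\<lambda>x. d x 0))"
    unfolding virtual_surplus_def S_def
    using s b1 by (subst (2) integral_diff) (auto intro!: ic continuous_intros cx)
  also have "integral {0..b2} S = integral {0..s} S + (integral {s..n} S + integral {n..b2} S)"
    using s integral_split_continuous[OF cS[of 0 b2], of s] integral_split_continuous[OF cS[of s b2], of n] by simp
  also have "integral {0..b1} (\<lambda>x. (c2 + b2) * d x b2) = integral {0..p} (\<lambda>x. (c2 + b2) * d x b2) + integral {p..b1} (\<lambda>x. (c2 + b2) * d x b2)"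
    using s p p0 b1 by (intro integral_split_continuous continuous_intros cx) auto
  finally show ?thesis
    using S1 S2 S3' T1 T2' mult_left_mono[OF B c(2)] by (simp add: algebra_simps)
qed

subsection \<open>The remaining one-dimensional inequalities\<close>

lemma integral_linear_times_affine:
  fixes u v \<alpha> \<beta> \<gamma> \<sigma> :: real
  assumes "u \<le> v"
  shows "integral {u..v} (\<lambda>y. (\<alpha> - \<beta> * y) * (\<gamma> + \<sigma> * y))
    = \<alpha> * \<gamma> * (v - u) + (\<alpha> * \<sigma> - \<beta> * \<gamma>) * (v^2 - u^2) / 2 - \<beta> * \<sigma> * (v^3 - u^3) / 3"
proof -
  let ?G = "\<lambda>y. \<alpha> * \<gamma> * y + (\<alpha> * \<sigma> - \<beta> * \<gamma>) * y^2 / 2 - \<beta> * \<sigma> * y^3 / 3"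
  have "((\<lambda>y. (\<alpha> - \<beta> * y) * (\<gamma> + \<sigma> * y)) has_integral (?G v - ?G u)) {u..v}"
    using assms by (intro fundamental_theorem_of_calculus)
      (auto intro!: derivative_eq_intros simp: has_real_derivative_iff_has_vector_derivative[symmetric] field_simps power2_eq_square)
  then show ?thesis by (simp add: integral_unique field_simps)
qed

lemma convex_on_chord:
  fixes \<psi> :: "real \<Rightarrow> real"
  assumes "convex_on {0..n} \<psi>" "0 < y\<^sub>0" "y\<^sub>0 \<le> n"
  shows "0 \<le> y \<Longrightarrow> y \<le> y\<^sub>0 \<Longrightarrow> \<psi> y \<le> \<psi> 0 + (\<psi> y\<^sub>0 - \<psi> 0) / y\<^sub>0 * y"
    and "y\<^sub>0 \<le> y \<Longrightarrow> y \<le> n \<Longrightarrow> \<psi> 0 + (\<psi> y\<^sub>0 - \<psi> 0) / y\<^sub>0 * y \<le> \<psi> y"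
proof -
  have scale: "\<psi> (t * z) \<le> (1 - t) * \<psi> 0 + t * \<psi> z" if "0 \<le> t" "t \<le> 1" "z \<in> {0..n}" for t z
    using convex_onD[OF assms(1), of t 0 z] that assms by simp
  show "\<psi> y \<le> \<psi> 0 + (\<psi> y\<^sub>0 - \<psi> 0) / y\<^sub>0 * y" if "0 \<le> y" "y \<le> y\<^sub>0"
    using scale[of "y / y\<^sub>0" y\<^sub>0] that assms by (simp add: field_simps)
  show "\<psi> 0 + (\<psi> y\<^sub>0 - \<psi> 0) / y\<^sub>0 * y \<le> \<psi> y" if "y\<^sub>0 \<le> y" "y \<le> n"
  proof -
    have "y > 0" using that assms by simp
    then have "\<psi> y\<^sub>0 \<le> (1 - y\<^sub>0 / y) * \<psi> 0 + y\<^sub>0 / y * \<psi> y"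
      using scale[of "y\<^sub>0 / y" y] that assms by simp
    then have "(\<psi> y\<^sub>0 - \<psi> 0) * y \<le> (\<psi> y - \<psi> 0) * y\<^sub>0" using \<open>y > 0\<close> by (simp add: field_simps)
    then show ?thesis using assms by (simp add: field_simps)
  qed
qed

text \<open>The convex \<open>\<psi>\<close> lies below its chord where the density is nonnegative
  and above it where the density is nonpositive, so replacing \<open>\<psi>\<close> by the chord
  increases the integral. The chord only sees the total mass and the first moment.\<close>

lemma crossing_integral_le_chord:
  fixes \<psi> :: "real \<Rightarrow> real"
  assumes "convex_on {0..n} \<psi>" "continuous_on {0..n} \<psi>" "0 < y\<^sub>0" "y\<^sub>0 \<le> v" "v \<le> n"
    and pos: "\<And>y. 0 \<le> y \<Longrightarrow> y \<le> y\<^sub>0 \<Longrightarrow> 0 \<le> \<alpha> - \<beta> * y" and neg: "\<And>y. y\<^sub>0 < y \<Longrightarrow> y \<le> v \<Longrightarrow> \<alpha> - \<beta> * y \<le> 0"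
  shows "integral {0..v} (\<lambda>y. (\<alpha> - \<beta> * y) * \<psi> y)
    \<le> \<psi> 0 * (\<alpha> * v - \<beta> * v^2 / 2) + (\<psi> y\<^sub>0 - \<psi> 0) / y\<^sub>0 * (\<alpha> * v^2 / 2 - \<beta> * v^3 / 3)"
proof -
  define \<sigma> where "\<sigma> = (\<psi> y\<^sub>0 - \<psi> 0) / y\<^sub>0"
  have "y\<^sub>0 \<le> n" using assms by simp
  note chord = convex_on_chord[OF assms(1,3) this, folded \<sigma>_def]
  have "continuous_on {0..v} \<psi>" using assms(2) by (rule continuous_on_subset) (use assms in auto)
  then have "integral {0..v} (\<lambda>y. (\<alpha> - \<beta> * y) * \<psi> y) \<le> integral {0..v} (\<lambda>y. (\<alpha> - \<beta> * y) * (\<psi> 0 + \<sigma> * y))"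
  proof (intro integral_le integrable_continuous_interval continuous_intros)
    fix y assume "y \<in> {0..v}"
    then show "(\<alpha> - \<beta> * y) * \<psi> y \<le> (\<alpha> - \<beta> * y) * (\<psi> 0 + \<sigma> * y)"
      using chord[of y] pos[of y] neg[of y] assms
      by (cases "y \<le> y\<^sub>0") (auto intro: mult_left_mono mult_left_mono_neg)
  qed auto
  also have "\<dots> = \<psi> 0 * (\<alpha> * v - \<beta> * v^2 / 2) + \<sigma> * (\<alpha> * v^2 / 2 - \<beta> * v^3 / 3)"
    using assms by (subst integral_linear_times_affine) (auto simp: field_simps)
  finally show ?thesis unfolding \<sigma>_def .
qed

lemma integral_linear_times_le_const:
  fixes \<psi> :: "real \<Rightarrow> real"
  assumes "continuous_on {u..v} \<psi>" "u \<le> v" "\<And>y. u \<le> y \<Longrightarrow> y \<le> v \<Longrightarrow> (\<alpha> - \<beta> * y) * \<psi> y \<le> (\<alpha> - \<beta> * y) * K"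
  shows "integral {u..v} (\<lambda>y. (\<alpha> - \<beta> * y) * \<psi> y) \<le> K * (\<alpha> * (v - u) - \<beta> * (v^2 - u^2) / 2)"
proof -
  have "integral {u..v} (\<lambda>y. (\<alpha> - \<beta> * y) * \<psi> y) \<le> integral {u..v} (\<lambda>y. (\<alpha> - \<beta> * y) * (K + 0 * y))"
    using assms by (intro integral_le integrable_continuous_interval continuous_intros) auto
  also have "\<dots> = K * (\<alpha> * (v - u) - \<beta> * (v^2 - u^2) / 2)"
    using assms by (subst integral_linear_times_affine) (auto simp: field_simps)
  finally show ?thesis .
qed

text \<open>
  The crossing height \<open>y\<^sub>0\<close> of the density exists because of \<open>2 * b1 - c1 \<le> p\<close>; \<open>\<psi>\<close> is compared
  with its chord through \<open>0\<close> and \<open>y\<^sub>0\<close>.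
\<close>

lemma vertical_nonpos:
  fixes \<psi> :: "real \<Rightarrow> real"
  assumes \<psi>: "convex_on {0..n} \<psi>" "continuous_on {0..n} \<psi>"
    and s: "0 < s" "s \<le> n" and b: "0 < b1" and a: "0 \<le> a" and p: "p = a * s" "2 * b1 - c1 \<le> p"
    and mass: "c1 * s + 3/2 * p * s - 2 * b1 * n = c2 * (b1 - p)"
    and moment: "0 \<le> s^2 * (c1 + p) / 2 - b1 * n^2"
      "s^2 * (c1 + p) / 2 - b1 * n^2 = 0 \<or> (\<forall>y\<in>{0..n}. \<psi> y \<le> \<psi> 0)"
  shows "integral {0..s} (\<lambda>y. (c1 - 2 * b1 + 3 * (a * (s - y))) * \<psi> y) - 2 * b1 * integral {s..n} \<psi>
       - c2 * (b1 - p) * \<psi> 0 \<le> 0"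
proof -
  define \<alpha> where "\<alpha> = c1 - 2 * b1 + 3 * p"
  define \<beta> where "\<beta> = 3 * a"
  \<comment> \<open>At \<open>s\<close> the linear density has the value \<open>c1 - 2 * b1\<close>,
    and beyond \<open>s\<close> the density is \<open>- 2 * b1\<close>. If the former is
    nonnegative, the sign changes by the jump at \<open>s\<close>; otherwise at the zero of the
    linear part.\<close>
  define y\<^sub>0 where "y\<^sub>0 = (if 2 * b1 \<le> c1 then s else \<alpha> / \<beta>)"
  have f: "c1 - 2 * b1 + 3 * (a * (s - y)) = \<alpha> - \<beta> * y" for y by (simp add: \<alpha>_def \<beta>_def p algebra_simps)
  have "0 < y\<^sub>0 \<and> y\<^sub>0 \<le> s \<and> (\<forall>y. 0 \<le> y \<longrightarrow> y \<le> y\<^sub>0 \<longrightarrow> 0 \<le> \<alpha> - \<beta> * y) \<and> (\<forall>y. y\<^sub>0 < y \<longrightarrow> y \<le> s \<longrightarrow> \<alpha> - \<beta> * y \<le> 0)"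
  proof (cases "2 * b1 \<le> c1")
    case True
    have "0 \<le> a * (s - y)" if "y \<le> s" for y using a that by simp
    then show ?thesis using True s by (auto simp: y\<^sub>0_def f[symmetric])
  next
    case False
    then have "0 < p" using p by simp
    then have "0 < \<beta>" using p s a by (auto simp: \<beta>_def zero_less_mult_iff)
    moreover have "0 < \<alpha>" "\<alpha> \<le> \<beta> * s" using False p \<open>0 < p\<close> by (auto simp: \<alpha>_def \<beta>_def)
    ultimately show ?thesis using False by (auto simp: y\<^sub>0_def field_simps)
  qed
  then have y0: "0 < y\<^sub>0" "y\<^sub>0 \<le> s" "\<And>y. 0 \<le> y \<Longrightarrow> y \<le> y\<^sub>0 \<Longrightarrow> 0 \<le> \<alpha> - \<beta> * y" "\<And>y. y\<^sub>0 < y \<Longrightarrow> y \<le> s \<Longrightarrow> \<alpha> - \<beta> * y \<le> 0"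
    by blast+
  define \<sigma> where "\<sigma> = (\<psi> y\<^sub>0 - \<psi> 0) / y\<^sub>0"
  have lower: "integral {0..s} (\<lambda>y. (\<alpha> - \<beta> * y) * \<psi> y) \<le> \<psi> 0 * (\<alpha> * s - \<beta> * s^2 / 2) + \<sigma> * (\<alpha> * s^2 / 2 - \<beta> * s^3 / 3)"
    unfolding \<sigma>_def using y0 s by (intro crossing_integral_le_chord[OF \<psi>]) auto
  have "continuous_on {s..n} \<psi>" using \<psi>(2) by (rule continuous_on_subset) (use s in auto)
  then have "integral {s..n} (\<lambda>y. (1 - 0 * y) * (\<psi> 0 + \<sigma> * y)) \<le> integral {s..n} \<psi>"
  proof (intro integral_le integrable_continuous_interval continuous_intros)
    fix y assume "y \<in> {s..n}"
    then show "(1 - 0 * y) * (\<psi> 0 + \<sigma> * y) \<le> \<psi> y"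
      using convex_on_chord(2)[OF \<psi>(1) y0(1), of y] y0(2) s by (simp add: \<sigma>_def)
  qed auto
  then have upper: "\<psi> 0 * (n - s) + \<sigma> * (n^2 - s^2) / 2 \<le> integral {s..n} \<psi>"
    using s by (subst (asm) integral_linear_times_affine) auto
  \<comment> \<open>Either the moment vanishes, or the chord has nonpositive slope and the moment is
    nonnegative.\<close>
  have "\<sigma> * (s^2 * (c1 + p) / 2 - b1 * n^2) \<le> 0"
  proof (cases "s^2 * (c1 + p) / 2 - b1 * n^2 = 0")
    case False
    then have "\<psi> y\<^sub>0 \<le> \<psi> 0" using moment(2) y0 s by auto
    then have "\<sigma> \<le> 0" using y0 by (simp add: \<sigma>_def divide_le_0_iff)
    then show ?thesis using moment(1) by (rule mult_nonpos_nonneg)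
  qed simp
  \<comment> \<open>Integrated against the chord, the coefficient of \<open>\<psi> 0\<close> cancels
    with the bottom edge by \<open>mass\<close>; only slope times first moment is left.\<close>
  moreover have "\<psi> 0 * (\<alpha> * s - \<beta> * s^2 / 2) + \<sigma> * (\<alpha> * s^2 / 2 - \<beta> * s^3 / 3) 
      - 2 * b1 * (\<psi> 0 * (n - s) + \<sigma> * (n^2 - s^2) / 2) - (c1 * s + 3/2 * p * s - 2 * b1 * n) * \<psi> 0
     = \<sigma> * (s^2 * (c1 + p) / 2 - b1 * n^2)"
    by (simp add: \<alpha>_def \<beta>_def p field_simps power2_eq_square power3_eq_cube)
  moreover have "2 * b1 * (\<psi> 0 * (n - s) + \<sigma> * (n^2 - s^2) / 2) \<le> 2 * b1 * integral {s..n} \<psi>"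
    using upper b by (intro mult_left_mono) auto
  ultimately show ?thesis using lower unfolding f mass by linarith
qed

text \<open>
  With \<open>e = 3 * p - P\<close>, the density \<open>e - 3 * y\<close> changes sign at \<open>e / 3\<close>, and its first moment over
  \<open>[0, e / 2]\<close> vanishes; its mass there is \<open>e\<^sup>2 / 8\<close>, which is where the last hypothesis comes from.
\<close>

lemma bundling_vertical_nonpos:
  fixes \<psi> :: "real \<Rightarrow> real"
  assumes \<psi>: "convex_on {0..p} \<psi>" "continuous_on {0..p} \<psi>"
    and anti: "\<And>y y'. 0 \<le> y \<Longrightarrow> y \<le> y' \<Longrightarrow> y' \<le> p \<Longrightarrow> \<psi> y' \<le> \<psi> y"
    and p: "0 < p" and F: "0 \<le> F" and w: "0 \<le> w"
    and mass: "(3 * p - P) * p - 3/2 * p^2 + w = F"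
    and disc: "p < P \<Longrightarrow> P < 3 * p \<Longrightarrow> (3 * p - P)^2 \<le> 8 * F"
  shows "integral {0..p} (\<lambda>y. (3 * p - P - 3 * y) * \<psi> y) - F * \<psi> 0 + w * \<psi> p \<le> 0"
proof -
  define e where "e = 3 * p - P"
  have mass': "e * p - 3/2 * p^2 = F - w" using mass by (simp add: e_def)
  have F\<psi>: "F * \<psi> p \<le> F * \<psi> 0" and w\<psi>: "w * \<psi> p \<le> w * \<psi> 0"
    using anti[of 0 p] p F w by (auto intro: mult_left_mono)
  have cont: "continuous_on {u..v} \<psi>" if "0 \<le> u" "v \<le> p" for u v
    using \<psi>(2) by (rule continuous_on_subset) (use that in auto)
  \<comment> \<open>The density is nonpositive; nonnegative; or it changes sign, with a first moment
    over \<open>[0, p]\<close> that is nonnegative (\<open>P \<le> p\<close>) or negative. In the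
    last case the integral is cut at \<open>e / 2\<close>, where the moment vanishes.\<close>
  consider "e \<le> 0" | "P \<le> 0" | "0 < e" "0 < P" "P \<le> p" | "0 < e" "p < P" by linarith
  then have "integral {0..p} (\<lambda>y. (e - 3 * y) * \<psi> y) - F * \<psi> 0 + w * \<psi> p \<le> 0"
  proof cases
    case 1
    have "integral {0..p} (\<lambda>y. (e - 3 * y) * \<psi> y) \<le> \<psi> p * (e * (p - 0) - 3 * (p^2 - 0^2) / 2)"
      using 1 p anti by (intro integral_linear_times_le_const cont mult_left_mono_neg) auto
    then have "integral {0..p} (\<lambda>y. (e - 3 * y) * \<psi> y) \<le> \<psi> p * (F - w)" using mass' by simp
    then show ?thesis using F\<psi> by (simp add: algebra_simps)
  next
    case 2
    have "integral {0..p} (\<lambda>y. (e - 3 * y) * \<psi> y) \<le> \<psi> 0 * (e * (p - 0) - 3 * (p^2 - 0^2) / 2)"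
      using 2 p anti by (intro integral_linear_times_le_const cont mult_left_mono) (auto simp: e_def)
    then have "integral {0..p} (\<lambda>y. (e - 3 * y) * \<psi> y) \<le> \<psi> 0 * (F - w)" using mass' by simp
    then show ?thesis using w\<psi> by (simp add: algebra_simps)
  next
    case 3
    have "integral {0..p} (\<lambda>y. (e - 3 * y) * \<psi> y)
        \<le> \<psi> 0 * (e * p - 3 * p^2 / 2) + (\<psi> (e/3) - \<psi> 0) / (e/3) * (e * p^2 / 2 - 3 * p^3 / 3)"
      using 3 p by (intro crossing_integral_le_chord[OF \<psi>]) (auto simp: e_def)
    also have "(\<psi> (e/3) - \<psi> 0) / (e/3) * (e * p^2 / 2 - 3 * p^3 / 3) \<le> 0"
    proof (rule mult_nonpos_nonneg)
      show "(\<psi> (e/3) - \<psi> 0) / (e/3) \<le> 0"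
        using anti[of 0 "e/3"] 3 by (auto simp: divide_le_0_iff e_def)
      have "e * p^2 / 2 - 3 * p^3 / 3 = p^2 * (p - P) / 2"
        by (simp add: e_def field_simps power2_eq_square power3_eq_cube)
      moreover have "0 \<le> p^2 * (p - P) / 2" using 3 by simp
      ultimately show "0 \<le> e * p^2 / 2 - 3 * p^3 / 3" by linarith
    qed
    finally have "integral {0..p} (\<lambda>y. (e - 3 * y) * \<psi> y) \<le> \<psi> 0 * (F - w)" using mass' by simp
    then show ?thesis using w\<psi> by (simp add: algebra_simps)
  next
    case 4
    let ?y = "e / 2"
    have y: "0 < ?y" "?y \<le> p" using 4 by (auto simp: e_def)
    have "integral {0..?y} (\<lambda>y. (e - 3 * y) * \<psi> y)
        \<le> \<psi> 0 * (e * ?y - 3 * ?y^2 / 2) + (\<psi> (e/3) - \<psi> 0) / (e/3) * (e * ?y^2 / 2 - 3 * ?y^3 / 3)"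
      using 4 y by (intro crossing_integral_le_chord[OF \<psi>]) auto
    also have "e * ?y^2 / 2 - 3 * ?y^3 / 3 = 0" by (simp add: field_simps power2_eq_square power3_eq_cube)
    also have "e * ?y - 3 * ?y^2 / 2 = e^2 / 8" by (simp add: field_simps power2_eq_square)
    finally have 1: "integral {0..?y} (\<lambda>y. (e - 3 * y) * \<psi> y) \<le> \<psi> 0 * (e^2 / 8)" by simp
    have "integral {?y..p} (\<lambda>y. (e - 3 * y) * \<psi> y) \<le> \<psi> p * (e * (p - ?y) - 3 * (p^2 - ?y^2) / 2)"
      using y anti by (intro integral_linear_times_le_const cont mult_left_mono_neg) auto
    also have "e * (p - ?y) - 3 * (p^2 - ?y^2) / 2 = F - w - e^2 / 8"
      using mass' by (simp add: field_simps power2_eq_square)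
    finally have 2: "integral {?y..p} (\<lambda>y. (e - 3 * y) * \<psi> y) \<le> \<psi> p * (F - w - e^2 / 8)" .
    \<comment> \<open>The lower piece uses \<open>e^2 / 8\<close> of the bottom mass
      \<open>F\<close> at height \<open>0\<close>. By \<open>disc\<close> the rest is nonnegative
      and can be moved up to \<open>p\<close>, where it cancels the upper piece together with
      \<open>w\<close>.\<close>
    have "0 \<le> (F - e^2 / 8) * (\<psi> 0 - \<psi> p)"
      using disc 4 anti[of 0 p] p by (intro mult_nonneg_nonneg) (auto simp: e_def)
    moreover have "integral {0..p} (\<lambda>y. (e - 3 * y) * \<psi> y)
        = integral {0..?y} (\<lambda>y. (e - 3 * y) * \<psi> y) + integral {?y..p} (\<lambda>y. (e - 3 * y) * \<psi> y)"
      using y by (intro integral_split_continuous continuous_intros cont) auto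
    moreover have "(F - e^2 / 8) * (\<psi> 0 - \<psi> p) + \<psi> 0 * (e^2 / 8) + \<psi> p * (F - w - e^2 / 8) = F * \<psi> 0 - w * \<psi> p"
      by (simp add: field_simps)
    ultimately show ?thesis using 1 2 by linarith
  qed
  then show ?thesis unfolding e_def .
qed

subsection \<open>Optimality of the two menus\<close>

lemma induced_exists:
  assumes "finite M" "M \<noteq> {}"
  shows "\<exists>q t. induced D M q t"
proof -
  have "\<exists>m. m \<in> M \<and> (\<forall>m'\<in>M. z \<bullet> fst m' - snd m' \<le> z \<bullet> fst m - snd m)" for z :: "real \<times> real"
  proof -
    let ?f = "\<lambda>m. z \<bullet> fst m - snd m"
    have "Max (?f ` M) \<in> ?f ` M" using assms by (intro Max_in) auto
    then obtain m where "m \<in> M" "Max (?f ` M) = ?f m" by auto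
    moreover have "?f m' \<le> Max (?f ` M)" if "m' \<in> M" for m' using assms that by (intro Max_ge) auto
    ultimately show ?thesis by metis
  qed
  then obtain m where m: "\<And>z. m z \<in> M" "\<And>z m'. m' \<in> M \<Longrightarrow> z \<bullet> fst m' - snd m' \<le> z \<bullet> fst (m z) - snd (m z)"
    by metis
  have "induced D M (\<lambda>z. fst (m z)) (\<lambda>z. snd (m z))"
    unfolding induced_def using assms m by fastforce
  then show ?thesis by blast
qed

lemma induced_mechanism:
  assumes ind: "induced D M q t" and M: "((0, 0), 0) \<in> M" "\<And>e x. (e, x) \<in> M \<Longrightarrow> e \<in> {0..1} \<times> {0..1} \<and> 0 \<le> x"
  shows "mechanism D q t" "incentive_compatible D q t" "individually_rational D q t"
proof -
  have in_M: "(q z, t z) \<in> M" and max: "\<And>e x. (e, x) \<in> M \<Longrightarrow> z \<bullet> e - x \<le> z \<bullet> q z - t z" if "z \<in> D" for z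
    using ind that unfolding induced_def by auto
  show "mechanism D q t" unfolding mechanism_def using in_M M(2) by blast
  show "incentive_compatible D q t" unfolding incentive_compatible_def using in_M max by blast
  show "individually_rational D q t" unfolding individually_rational_def
    using max[OF _ M(1)] by (auto simp: zero_prod_def[symmetric])
qed

lemma virtual_surplus_diff:
  assumes u: "continuous_on ({0..b1} \<times> {0..b2}) (\<lambda>(x, y). u x y)"
    and v: "continuous_on ({0..b1} \<times> {0..b2}) (\<lambda>(x, y). v x y)" and b: "0 \<le> b1" "0 \<le> b2"
  shows "virtual_surplus c1 c2 b1 b2 (\<lambda>x y. u x y - v x y) = virtual_surplus c1 c2 b1 b2 u - virtual_surplus c1 c2 b1 b2 v"
proof -
  note ic = integrable_continuous_interval
  have cu: "continuous_on {0..b2} (\<lambda>y. u x y)" "continuous_on {0..b2} (\<lambda>y. v x y)" if "0 \<le> x" "x \<le> b1" for x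
    using continuous_on_slices(2)[OF u, of x] continuous_on_slices(2)[OF v, of x] that by auto
  have cv: "continuous_on {0..b1} (\<lambda>x. u x y)" "continuous_on {0..b1} (\<lambda>x. v x y)" if "0 \<le> y" "y \<le> b2" for y
    using continuous_on_slices(1)[OF u, of y] continuous_on_slices(1)[OF v, of y] that by auto
  note ci = continuous_on_slice_integral(2)[OF u] continuous_on_slice_integral(2)[OF v]
  have "integral {0..b2} (\<lambda>y. (c1 + b1) * (u b1 y - v b1 y) - c1 * (u 0 y - v 0 y) - 3 * integral {0..b1} (\<lambda>x. u x y - v x y))
    = integral {0..b2} (\<lambda>y. ((c1 + b1) * u b1 y - c1 * u 0 y - 3 * integral {0..b1} (\<lambda>x. u x y)) 
        - ((c1 + b1) * v b1 y - c1 * v 0 y - 3 * integral {0..b1} (\<lambda>x. v x y)))"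
  proof (rule Henstock_Kurzweil_Integration.integral_cong)
    fix y assume "y \<in> {0..b2}"
    then have "integral {0..b1} (\<lambda>x. u x y - v x y) = integral {0..b1} (\<lambda>x. u x y) - integral {0..b1} (\<lambda>x. v x y)"
      by (intro integral_diff ic cv) auto
    then show "(c1 + b1) * (u b1 y - v b1 y) - c1 * (u 0 y - v 0 y) - 3 * integral {0..b1} (\<lambda>x. u x y - v x y)
       = ((c1 + b1) * u b1 y - c1 * u 0 y - 3 * integral {0..b1} (\<lambda>x. u x y)) 
        - ((c1 + b1) * v b1 y - c1 * v 0 y - 3 * integral {0..b1} (\<lambda>x. v x y))"
      by (simp add: algebra_simps)
  qed
  also have "\<dots> = integral {0..b2} (\<lambda>y. (c1 + b1) * u b1 y - c1 * u 0 y - 3 * integral {0..b1} (\<lambda>x. u x y)) 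
        - integral {0..b2} (\<lambda>y. (c1 + b1) * v b1 y - c1 * v 0 y - 3 * integral {0..b1} (\<lambda>x. v x y))"
    using b by (intro integral_diff ic continuous_intros cu ci) auto
  finally have 1: "integral {0..b2} (\<lambda>y. (c1 + b1) * (u b1 y - v b1 y) - c1 * (u 0 y - v 0 y) - 3 * integral {0..b1} (\<lambda>x. u x y - v x y)) = \<dots>" .
  have "integral {0..b1} (\<lambda>x. (c2 + b2) * (u x b2 - v x b2) - c2 * (u x 0 - v x 0))
     = integral {0..b1} (\<lambda>x. ((c2 + b2) * u x b2 - c2 * u x 0) - ((c2 + b2) * v x b2 - c2 * v x 0))"
    by (intro Henstock_Kurzweil_Integration.integral_cong) (simp add: algebra_simps)
  also have "\<dots> = integral {0..b1} (\<lambda>x. (c2 + b2) * u x b2 - c2 * u x 0) - integral {0..b1} (\<lambda>x. (c2 + b2) * v x b2 - c2 * v x 0)"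
    using b by (intro integral_diff ic continuous_intros cv) auto
  finally show ?thesis unfolding virtual_surplus_def 1 by simp
qed

text \<open>A competitor enters only through its utility, and the functional is linear; so it
  suffices to bound it on the difference for all nonnegative \<open>u\<close> with slopes in
  \<open>[0, 1]\<close>.\<close>

lemma optimal_menuI:
  assumes D: "D = {c1..c1 + b1} \<times> {c2..c2 + b2}" and c: "0 \<le> c1" "0 \<le> c2" and b: "0 < b1" "0 < b2"
    and M: "finite M" "((0, 0), 0) \<in> M" "\<And>e x. (e, x) \<in> M \<Longrightarrow> e \<in> {0..1} \<times> {0..1} \<and> 0 \<le> x"
    and dual: "\<And>q t u g1 g2. induced D M q t \<Longrightarrow> bounded_subgradient b1 b2 u g1 g2 \<Longrightarrow> 
        (\<And>x y. x \<in> {0..b1} \<Longrightarrow> y \<in> {0..b2} \<Longrightarrow> 0 \<le> u x y) \<Longrightarrow>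
        virtual_surplus c1 c2 b1 b2 (\<lambda>x y. u x y - shifted_utility c1 c2 q t x y) \<le> 0"
  shows "optimal_menu D M"
  unfolding optimal_menu_def optimal_def
proof (intro conjI allI impI)
  show "\<exists>q t. induced D M q t" using M by (intro induced_exists) auto
  fix q t assume ind: "induced D M q t"
  note mech = induced_mechanism[OF ind M(2,3)]
  then show "mechanism D q t" "incentive_compatible D q t" "individually_rational D q t" by auto
  fix q' t' assume mech': "mechanism D q' t' \<and> incentive_compatible D q' t' \<and> individually_rational D q' t'"
  let ?u = "shifted_utility c1 c2 q t" and ?u' = "shifted_utility c1 c2 q' t'"
  have sg: "bounded_subgradient b1 b2 ?u (\<lambda>x y. fst (q (c1 + x, c2 + y))) (\<lambda>x y. snd (q (c1 + x, c2 + y)))"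
    "bounded_subgradient b1 b2 ?u' (\<lambda>x y. fst (q' (c1 + x, c2 + y))) (\<lambda>x y. snd (q' (c1 + x, c2 + y)))"
    using mech mech' by (auto intro!: bounded_subgradient_shifted_utility simp: D)
  have "0 \<le> ?u' x y" if "x \<in> {0..b1}" "y \<in> {0..b2}" for x y
    using mech' that unfolding individually_rational_def shifted_utility_def D by auto
  from dual[OF ind sg(2) this] have "virtual_surplus c1 c2 b1 b2 (\<lambda>x y. ?u' x y - ?u x y) \<le> 0" .
  moreover have "virtual_surplus c1 c2 b1 b2 (\<lambda>x y. ?u' x y - ?u x y) = virtual_surplus c1 c2 b1 b2 ?u' - virtual_surplus c1 c2 b1 b2 ?u"
    using b by (intro virtual_surplus_diff bounded_subgradient_continuous[OF sg(1)] bounded_subgradient_continuous[OF sg(2)]) auto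
  ultimately have "virtual_surplus c1 c2 b1 b2 ?u' \<le> virtual_surplus c1 c2 b1 b2 ?u" by simp
  then show "revenue D t' \<le> revenue D t"
    using mech mech' b c unfolding D
    by (subst (1 2) revenue_eq_virtual_surplus) (auto intro!: divide_right_mono)
qed

text \<open>Shared by both menus: \<open>n\<close> is \<open>(b2 - c2) / 2\<close> for the first,
  and the larger of that and \<open>p\<close> for bundling, where \<open>a = 1\<close> and
  \<open>s = p\<close>. For \<open>a = 1\<close> the subtracted utility rises in \<open>y\<close> at
  the maximal rate 1 on the averaged strip, so \<open>\<psi>\<close> decreases.\<close>

lemma
  fixes u v :: "real \<Rightarrow> real \<Rightarrow> real"
  assumes sg: "bounded_subgradient b1 b2 u g1 g2"
    and pos: "\<And>x y. x \<in> {0..b1} \<Longrightarrow> y \<in> {0..b2} \<Longrightarrow> 0 \<le> u x y"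
    and v: "continuous_on ({0..b1} \<times> {0..b2}) (\<lambda>(x, y). v x y)"
    and c: "0 \<le> c1" "0 \<le> c2" and a: "0 \<le> a" and s: "0 \<le> s" "s \<le> n" "n < b2"
    and p: "p = a * s" "p < b1"
    and v0: "\<And>x y. x \<in> {0..b1} \<Longrightarrow> 0 \<le> y \<Longrightarrow> y \<le> s \<Longrightarrow> x \<le> a * (s - y) \<Longrightarrow> v x y = 0"
    and vx: "\<And>x x' y. y \<in> {0..b2} \<Longrightarrow> 0 \<le> x \<Longrightarrow> a * (s - y) \<le> x \<Longrightarrow> x \<le> x' \<Longrightarrow> x' \<le> b1 \<Longrightarrow> v x' y = v x y + (x' - x)"
    and vy: "\<And>x y y'. x \<in> {0..b1} \<Longrightarrow> n \<le> y \<Longrightarrow> y \<le> y' \<Longrightarrow> y' \<le> b2 \<Longrightarrow> v x y' = v x y + (y' - y)"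
    and va: "\<And>x y. p \<le> x \<Longrightarrow> x \<le> b1 \<Longrightarrow> 0 \<le> y \<Longrightarrow> y \<le> n \<Longrightarrow> v x y = v x 0 + a * y"
  defines "\<psi> \<equiv> \<lambda>y. integral {p..b1} (\<lambda>x. u x y - v x y) / (b1 - p)"
  shows virtual_surplus_deviation_le:
     "0 \<le> w \<Longrightarrow> (c2 + b2) * p + (c2 + b2 - w) * (b1 - p) = 2 * b1 * (b2 - n) \<Longrightarrow>
      (c2 + b2) * p \<le> (c1 + 3 * p) * (b2 - n) \<Longrightarrow>
      virtual_surplus c1 c2 b1 b2 (\<lambda>x y. u x y - v x y)
       \<le> integral {0..s} (\<lambda>y. (c1 - 2 * b1 + 3 * (a * (s - y))) * \<psi> y) - 2 * b1 * integral {s..n} \<psi>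
         - c2 * (b1 - p) * \<psi> 0 + w * (b1 - p) * \<psi> n"
    and deviation_average_continuous: "continuous_on {0..n} \<psi>"
    and deviation_average_convex: "convex_on {0..n} \<psi>"
    and deviation_average_antimono: "a = 1 \<Longrightarrow> 0 \<le> y \<Longrightarrow> y \<le> y' \<Longrightarrow> y' \<le> n \<Longrightarrow> \<psi> y' \<le> \<psi> y"
proof -
  let ?d = "\<lambda>x y. u x y - v x y"
  have p0: "0 \<le> p" using p a s by simp
  have "0 \<le> b1" "0 \<le> b2" using p0 p s by auto
  then have u: "continuous_on ({0..b1} \<times> {0..b2}) (\<lambda>(x, y). u x y)" by (rule bounded_subgradient_continuous[OF sg])
  have d: "continuous_on ({0..b1} \<times> {0..b2}) (\<lambda>(x, y). ?d x y)"
    using continuous_on_diff[OF u v] by (simp add: case_prod_beta')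
  have dn: "continuous_on ({p..b1} \<times> {0..n}) (\<lambda>(x, y). ?d x y)"
    using d by (rule continuous_on_subset) (use p0 s in auto)
  have int: "(\<lambda>x. ?d x y) integrable_on {p..b1}" if "0 \<le> y" "y \<le> n" for y
    using continuous_on_slices(1)[OF dn] that by (intro integrable_continuous_interval) auto
  show "continuous_on {0..n} \<psi>"
    unfolding \<psi>_def using p by (intro continuous_intros continuous_on_slice_integral(2)[OF dn]) auto
  show "convex_on {0..n} \<psi>"
  proof (rule convex_onI)
    fix \<theta> y y' :: real assume \<theta>: "0 < \<theta>" "\<theta> < 1" and y: "y \<in> {0..n}" "y' \<in> {0..n}"
    let ?m = "(1 - \<theta>) *\<^sub>R y + \<theta> *\<^sub>R y'"
    have m: "?m \<in> {0..n}" using convex_real_interval(5)[of 0 n] y \<theta> unfolding convex_alt by auto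
    have "integral {p..b1} (\<lambda>x. ?d x ?m) \<le> integral {p..b1} (\<lambda>x. (1 - \<theta>) * ?d x y + \<theta> * ?d x y')"
    proof (rule integral_le)
      fix x assume x: "x \<in> {p..b1}"
      have "convex_on {0..b2} (u x)" using x p0 by (intro bounded_subgradient_convex[OF sg]) auto
      then have "u x ?m \<le> (1 - \<theta>) * u x y + \<theta> * u x y'" using \<theta> y s by (intro convex_onD) auto
      then show "?d x ?m \<le> (1 - \<theta>) * ?d x y + \<theta> * ?d x y'"
        using va[of x ?m] va[of x y] va[of x y'] x y m by (simp add: algebra_simps)
    qed (use m y in \<open>auto intro!: int integrable_add integrable_on_mult_right simp del: real_scaleR_def\<close>)
    also have "\<dots> = (1 - \<theta>) * integral {p..b1} (\<lambda>x. ?d x y) + \<theta> * integral {p..b1} (\<lambda>x. ?d x y')"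
      using y by (subst integral_add) (auto intro!: int integrable_on_mult_right)
    finally show "\<psi> ?m \<le> (1 - \<theta>) * \<psi> y + \<theta> * \<psi> y'"
      using p unfolding \<psi>_def by (simp add: divide_simps)
  qed simp
  show "\<psi> y' \<le> \<psi> y" if "a = 1" "0 \<le> y" "y \<le> y'" "y' \<le> n" for y y'
    unfolding \<psi>_def
  proof (intro divide_right_mono integral_le int)
    fix x assume x: "x \<in> {p..b1}"
    then show "?d x y' \<le> ?d x y"
      using bounded_subgradient_slope_y[OF sg, of y y' x] va[of x y] va[of x y'] that s p0 by auto
  qed (use that p in auto)
  show "virtual_surplus c1 c2 b1 b2 ?d
       \<le> integral {0..s} (\<lambda>y. (c1 - 2 * b1 + 3 * (a * (s - y))) * \<psi> y) - 2 * b1 * integral {s..n} \<psi>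
         - c2 * (b1 - p) * \<psi> 0 + w * (b1 - p) * \<psi> n"
    if "0 \<le> w" "(c2 + b2) * p + (c2 + b2 - w) * (b1 - p) = 2 * b1 * (b2 - n)" "(c2 + b2) * p \<le> (c1 + 3 * p) * (b2 - n)"
    unfolding \<psi>_def
  proof (rule virtual_surplus_le_vertical[OF d c a s p that])
    show "0 \<le> ?d x y" if "0 \<le> x" "0 \<le> y" "y \<le> s" "x \<le> a * (s - y)" for x y
    proof -
      have "a * (s - y) \<le> a * s" using that a by (intro mult_left_mono) auto
      then have "x \<in> {0..b1}" using that p by auto
      then show ?thesis using v0[of x y] pos[of x y] that s by auto
    qed
    show "?d x' y \<le> ?d x y" if "0 \<le> y" "y \<le> b2" "0 \<le> x" "a * (s - y) \<le> x" "x \<le> x'" "x' \<le> b1" for x x' y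
      using bounded_subgradient_slope_x[OF sg, of x x' y] vx[of y x x'] that by auto
    show "?d x y' \<le> ?d x y" if "0 \<le> x" "x \<le> b1" "n \<le> y" "y \<le> y'" "y' \<le> b2" for x y y'
      using bounded_subgradient_slope_y[OF sg, of y y' x] vy[of x y y'] that s by auto
  qed
qed

section \<open>Utility and optimality of each menu\<close>

lemma a2_menu_utility:
  assumes "induced D (a2_menu c1 c2 b2 p a) q t" "(c1 + x, c2 + y) \<in> D"
  shows "shifted_utility c1 c2 q t x y = max 0 (max (x + a * y - p) (x + y - p - (1 - a) * ((b2 - c2) / 2)))"
proof -
  let ?z = "(c1 + x, c2 + y)"
  have in_M: "(q ?z, t ?z) \<in> a2_menu c1 c2 b2 p a"
    and max: "\<And>e p'. (e, p') \<in> a2_menu c1 c2 b2 p a \<Longrightarrow> ?z \<bullet> e - p' \<le> ?z \<bullet> q ?z - t ?z"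
    using assms unfolding induced_def by auto
  have "0 \<le> shifted_utility c1 c2 q t x y"
    "x + a * y - p \<le> shifted_utility c1 c2 q t x y"
    "x + y - p - (1 - a) * ((b2 - c2) / 2) \<le> shifted_utility c1 c2 q t x y"
    using max[of "(0, 0)" 0] max[of "(1, a)" "c1 + a * c2 + p"] max[of "(1, 1)" "c1 + c2 + p + (1 - a) * (b2 - c2) / 2"]
    by (simp_all add: a2_menu_def shifted_utility_def algebra_simps)
  moreover have "shifted_utility c1 c2 q t x y
      \<in> {0, x + a * y - p, x + y - p - (1 - a) * ((b2 - c2) / 2)}"
    using in_M unfolding a2_menu_def shifted_utility_def by (auto simp: algebra_simps)
  ultimately show ?thesis by (auto simp: max_def)
qed

lemma bundle_utility:
  assumes "induced D {((0, 0), 0), ((1, 1), c1 + c2 + p)} q t" "(c1 + x, c2 + y) \<in> D"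
  shows "shifted_utility c1 c2 q t x y = max 0 (x + y - p)"
proof -
  let ?z = "(c1 + x, c2 + y)" and ?M = "{((0, 0), 0), ((1, 1), c1 + c2 + p)} :: (alloc \<times> real) set"
  have in_M: "(q ?z, t ?z) \<in> ?M"
    and max: "\<And>e p'. (e, p') \<in> ?M \<Longrightarrow> ?z \<bullet> e - p' \<le> ?z \<bullet> q ?z - t ?z"
    using assms unfolding induced_def by auto
  have "0 \<le> shifted_utility c1 c2 q t x y" "x + y - p \<le> shifted_utility c1 c2 q t x y"
    using max[of "(0, 0)" 0] max[of "(1, 1)" "c1 + c2 + p"]
    by (simp_all add: shifted_utility_def algebra_simps)
  moreover have "shifted_utility c1 c2 q t x y \<in> {0, x + y - p}"
    using in_M unfolding shifted_utility_def by (auto simp: algebra_simps)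
  ultimately show ?thesis by (auto simp: max_def)
qed

text \<open>\<open>s\<close> is the height at which the region without sale meets the left edge, so
  \<open>a = p / s\<close> when \<open>p\<close> is positive. Then \<open>mass\<close> and
  \<open>moment\<close> are the two formulas for \<open>a2\<close>, the second one squared, with the
  factor \<open>p\<close> removed.\<close>

lemma a2_menu_optimal:
  assumes D: "D = {c1..c1 + b1} \<times> {c2..c2 + b2}" and c: "0 \<le> c1" "0 \<le> c2" and b: "0 < b1" "0 < b2"
    and a: "0 \<le> a" "a \<le> 1" and s: "0 < s" "s \<le> (b2 - c2) / 2" and p: "p = a * s" "p < b1" "2 * b1 - c1 \<le> p"
    and mass: "s * (3/2 * p + c1) = b1 * b2 - c2 * p" and moment: "2 * s^2 * (c1 + p) = b1 * (b2 - c2)^2"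
  shows "optimal_menu D (a2_menu c1 c2 b2 p a)"
proof (rule optimal_menuI[OF D c b])
  define m where "m = (b2 - c2) / 2"
  have m: "s \<le> m" "m < b2" using s c b by (auto simp: m_def)
  have p0: "0 \<le> p" using p a s by simp
  show "finite (a2_menu c1 c2 b2 p a)" "((0, 0), 0) \<in> a2_menu c1 c2 b2 p a" by (auto simp: a2_menu_def)
  show "e \<in> {0..1} \<times> {0..1} \<and> 0 \<le> x" if "(e, x) \<in> a2_menu c1 c2 b2 p a" for e x
    using that a c b p0 s unfolding a2_menu_def by auto
  fix q t u g1 g2 assume ind: "induced D (a2_menu c1 c2 b2 p a) q t" and sg: "bounded_subgradient b1 b2 u g1 g2"
    and pos: "\<And>x y. x \<in> {0..b1} \<Longrightarrow> y \<in> {0..b2} \<Longrightarrow> 0 \<le> u x y"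
  define v where "v = (\<lambda>x y. max 0 (max (x + a * y - p) (x + y - p - (1 - a) * m)))"
  have "shifted_utility c1 c2 q t x y = v x y" if "x \<in> {0..b1}" "y \<in> {0..b2}" for x y
    unfolding v_def m_def using that by (intro a2_menu_utility[OF ind]) (auto simp: D)
  then have "virtual_surplus c1 c2 b1 b2 (\<lambda>x y. u x y - shifted_utility c1 c2 q t x y)
     = virtual_surplus c1 c2 b1 b2 (\<lambda>x y. u x y - v x y)"
    using b by (intro virtual_surplus_cong) auto
  also have "\<dots> \<le> 0"
  proof -
    have third: "x + y - p - (1 - a) * m = (x + a * y - p) + (1 - a) * (y - m)" for x y by (simp add: algebra_simps)
    have low: "v x y = max 0 (x + a * y - p)" if "y \<le> m" for x y
    proof -
      have "(1 - a) * (y - m) \<le> 0" using that a by (intro mult_nonneg_nonpos) auto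
      then show ?thesis unfolding v_def third by auto
    qed
    have high: "v x y = x + y - p - (1 - a) * m" if "m \<le> y" "0 \<le> x" for x y
    proof -
      have "0 \<le> (1 - a) * (y - m)" "a * s \<le> a * y" using that a m by (auto intro!: mult_nonneg_nonneg mult_left_mono)
      then show ?thesis unfolding v_def third using that p by auto
    qed
    have cont: "continuous_on ({0..b1} \<times> {0..b2}) (\<lambda>(x, y). v x y)"
      unfolding v_def case_prod_beta' by (intro continuous_intros)
    have v0: "v x y = 0" if "y \<le> s" "x \<le> a * (s - y)" for x y
      using that p m by (subst low) (auto simp: algebra_simps)
    have vx: "v x' y = v x y + (x' - x)" if "0 \<le> x" "a * (s - y) \<le> x" "x \<le> x'" for x x' y
    proof (cases "y \<le> m")
      case True
      then show ?thesis using that p by (simp add: low algebra_simps)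
    next
      case False
      then show ?thesis using that by (simp add: high)
    qed
    have vy: "v x y' = v x y + (y' - y)" if "x \<in> {0..b1}" "m \<le> y" "y \<le> y'" for x y y'
      using that by (simp add: high)
    have va: "v x y = v x 0 + a * y" if "p \<le> x" "0 \<le> y" "y \<le> m" for x y
    proof -
      have "0 \<le> a * y" "0 \<le> m" using that a m s by auto
      then show ?thesis using that low[of y x] low[of 0 x] by linarith
    qed
    have balance: "(c2 + b2) * p + (c2 + b2 - 0) * (b1 - p) = 2 * b1 * (b2 - m)" 
      by (simp add: m_def field_simps)
    have left: "(c2 + b2) * p \<le> (c1 + 3 * p) * (b2 - m)"
    proof -
      have "(c1 + 3 * p) * (b2 - m) - (c2 + b2) * p = (c1 + p) * ((b2 + c2) / 2)" by (simp add: m_def field_simps)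
      also have "\<dots> \<ge> 0" using c b p0 by simp
      finally show ?thesis by simp
    qed
    note props = sg pos cont c a(1) less_imp_le[OF s(1)] m p(1,2) v0 vx vy va
    define \<psi> where "\<psi> = (\<lambda>y. integral {p..b1} (\<lambda>x. u x y - v x y) / (b1 - p))"
    have 1: "virtual_surplus c1 c2 b1 b2 (\<lambda>x y. u x y - v x y)
       \<le> integral {0..s} (\<lambda>y. (c1 - 2 * b1 + 3 * (a * (s - y))) * \<psi> y) - 2 * b1 * integral {s..m} \<psi>
         - c2 * (b1 - p) * \<psi> 0 + 0 * (b1 - p) * \<psi> m"
      unfolding \<psi>_def by (rule virtual_surplus_deviation_le[OF props _ balance left]) auto
    have "integral {0..s} (\<lambda>y. (c1 - 2 * b1 + 3 * (a * (s - y))) * \<psi> y) - 2 * b1 * integral {s..m} \<psi> - c2 * (b1 - p) * \<psi> 0 \<le> 0"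
    proof (rule vertical_nonpos)
      show "convex_on {0..m} \<psi>" unfolding \<psi>_def by (rule deviation_average_convex[OF props]) auto
      show "continuous_on {0..m} \<psi>" unfolding \<psi>_def by (rule deviation_average_continuous[OF props]) auto
      show "c1 * s + 3/2 * p * s - 2 * b1 * m = c2 * (b1 - p)" using mass by (simp add: m_def field_simps)
      have "s^2 * (c1 + p) / 2 - b1 * m^2 = 0" using moment by (simp add: m_def field_simps power2_eq_square)
      then show "0 \<le> s^2 * (c1 + p) / 2 - b1 * m^2" "s^2 * (c1 + p) / 2 - b1 * m^2 = 0 \<or> (\<forall>y\<in>{0..m}. \<psi> y \<le> \<psi> 0)"
        by auto
    qed (use s m b a p in auto)
    then show ?thesis using 1 by simp
  qed
  finally show "virtual_surplus c1 c2 b1 b2 (\<lambda>x y. u x y - shifted_utility c1 c2 q t x y) \<le> 0" .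
qed

text \<open>If \<open>p\<close> is at most \<open>(b2 - c2) / 2\<close>, the argument for the other
  menu applies with a nonnegative first moment. Otherwise \<open>n\<close> has to be raised to
  \<open>p\<close>, which leaves surplus mass on the top edge.\<close>

lemma bundling_optimal:
  assumes D: "D = {c1..c1 + b1} \<times> {c2..c2 + b2}" and c: "0 \<le> c1" "0 \<le> c2" and b: "0 < b1" "0 < b2"
    and c1: "b1 \<le> c1" and p: "0 < p" "p < b1" and mass: "3/2 * p^2 + (c1 + c2) * p = b1 * b2"
    and moment: "b1 * (b2 - c2)^2 \<le> 2 * p^2 * (c1 + p)" and c2: "c2 \<le> b2"
    and disc: "p < 2 * b1 - c1 \<Longrightarrow> 2 * b1 - c1 < 3 * p \<Longrightarrow> (3 * p - (2 * b1 - c1))^2 \<le> 8 * (c2 * (b1 - p))"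
  shows "optimal_menu D {((0, 0), 0), ((1, 1), c1 + c2 + p)}"
proof (rule optimal_menuI[OF D c b])
  let ?M = "{((0, 0), 0), ((1, 1), c1 + c2 + p)} :: (alloc \<times> real) set"
  define m where "m = (b2 - c2) / 2"
  have m: "0 \<le> m" "m < b2" using c2 c b by (auto simp: m_def)
  have "b1 * p < b1 * b2"
  proof -
    have "b1 * p \<le> c1 * p" "0 < p^2" "0 \<le> c2 * p" using c1 c p by auto
    moreover have "3/2 * p^2 + c1 * p + c2 * p = b1 * b2" using mass by (simp add: algebra_simps)
    ultimately show ?thesis by linarith
  qed
  then have pb2: "p < b2" using b by simp
  show "finite ?M" "((0, 0), 0) \<in> ?M" by auto
  show "e \<in> {0..1} \<times> {0..1} \<and> 0 \<le> x" if "(e, x) \<in> ?M" for e x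
    using that c p by auto
  fix q t u g1 g2 assume ind: "induced D ?M q t" and sg: "bounded_subgradient b1 b2 u g1 g2"
    and pos: "\<And>x y. x \<in> {0..b1} \<Longrightarrow> y \<in> {0..b2} \<Longrightarrow> 0 \<le> u x y"
  define v where "v = (\<lambda>x y. max 0 (x + y - p))"
  have "shifted_utility c1 c2 q t x y = v x y" if "x \<in> {0..b1}" "y \<in> {0..b2}" for x y
    unfolding v_def using that by (intro bundle_utility[OF ind]) (auto simp: D)
  then have "virtual_surplus c1 c2 b1 b2 (\<lambda>x y. u x y - shifted_utility c1 c2 q t x y)
     = virtual_surplus c1 c2 b1 b2 (\<lambda>x y. u x y - v x y)"
    using b by (intro virtual_surplus_cong) auto
  also have "\<dots> \<le> 0"
  proof -
    have cont: "continuous_on ({0..b1} \<times> {0..b2}) (\<lambda>(x, y). v x y)"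
      unfolding v_def case_prod_beta' by (intro continuous_intros)
    have pe: "p = 1 * p" by simp
    have v0: "v x y = 0" if "x \<le> 1 * (p - y)" for x y using that by (simp add: v_def)
    have vx: "v x' y = v x y + (x' - x)" if "1 * (p - y) \<le> x" "x \<le> x'" for x x' y
      using that by (simp add: v_def)
    have vy: "v x y' = v x y + (y' - y)" if "x \<in> {0..b1}" "p \<le> y" "y \<le> y'" for x y y'
      using that by (simp add: v_def)
    have va: "v x y = v x 0 + 1 * y" if "p \<le> x" "0 \<le> y" for x y
      using that by (simp add: v_def)
    note props = sg pos cont c zero_le_one less_imp_le[OF p(1)] _ _ pe p(2) v0 vx vy va
    define \<psi> where "\<psi> = (\<lambda>y. integral {p..b1} (\<lambda>x. u x y - v x y) / (b1 - p))"
    show ?thesis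
    proof (cases "p \<le> m")
      case True
      have balance: "(c2 + b2) * p + (c2 + b2 - 0) * (b1 - p) = 2 * b1 * (b2 - m)" 
        by (simp add: m_def field_simps)
      have left: "(c2 + b2) * p \<le> (c1 + 3 * p) * (b2 - m)"
      proof -
        have "(c1 + 3 * p) * (b2 - m) - (c2 + b2) * p = (c1 + p) * ((b2 + c2) / 2)" by (simp add: m_def field_simps)
        also have "\<dots> \<ge> 0" using c b p by simp
        finally show ?thesis by simp
      qed
      have 1: "virtual_surplus c1 c2 b1 b2 (\<lambda>x y. u x y - v x y)
         \<le> integral {0..p} (\<lambda>y. (c1 - 2 * b1 + 3 * (1 * (p - y))) * \<psi> y) - 2 * b1 * integral {p..m} \<psi>
           - c2 * (b1 - p) * \<psi> 0 + 0 * (b1 - p) * \<psi> m"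
        unfolding \<psi>_def by (rule virtual_surplus_deviation_le[OF props _ balance left]) (use True m in auto)
      have anti: "\<psi> y \<le> \<psi> 0" if "y \<in> {0..m}" for y
        unfolding \<psi>_def by (rule deviation_average_antimono[OF props, of m]) (use True m that in auto)
      have mom: "2 * b1 * m^2 \<le> p^2 * (c1 + p)"
        using moment by (simp add: m_def field_simps power2_eq_square)
      \<comment> \<open>Here the moment hypothesis itself forces \<open>2 * b1 - c1 \<le> p\<close>,
        the sign condition of \<open>vertical_nonpos\<close>.\<close>
      have "p^2 \<le> m^2" using True p by (intro power_mono) auto
      then have "2 * b1 * p^2 \<le> 2 * b1 * m^2" using b by (intro mult_left_mono) auto
      with mom have "2 * b1 * p^2 \<le> p^2 * (c1 + p)" by linarith
      then have "p^2 * (2 * b1) \<le> p^2 * (c1 + p)" by (simp only: mult.commute)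
      then have "2 * b1 - c1 \<le> p" using p by simp
      have "integral {0..p} (\<lambda>y. (c1 - 2 * b1 + 3 * (1 * (p - y))) * \<psi> y) - 2 * b1 * integral {p..m} \<psi> - c2 * (b1 - p) * \<psi> 0 \<le> 0"
      proof (rule vertical_nonpos)
        show "convex_on {0..m} \<psi>" unfolding \<psi>_def by (rule deviation_average_convex[OF props]) (use True m in auto)
        show "continuous_on {0..m} \<psi>" unfolding \<psi>_def by (rule deviation_average_continuous[OF props]) (use True m in auto)
        show "c1 * p + 3/2 * p * p - 2 * b1 * m = c2 * (b1 - p)" using mass by (simp add: m_def field_simps power2_eq_square)
        show "0 \<le> p^2 * (c1 + p) / 2 - b1 * m^2" using mom by simp
        show "p^2 * (c1 + p) / 2 - b1 * m^2 = 0 \<or> (\<forall>y\<in>{0..m}. \<psi> y \<le> \<psi> 0)"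
          using anti by auto
      qed (use True m b p \<open>2 * b1 - c1 \<le> p\<close> in auto)
      then show ?thesis using 1 by simp
    next
      case False
      \<comment> \<open>The lines between \<open>m\<close> and \<open>p\<close>, each of mass
        \<open>- 2 * b1\<close>, no longer draw on the top edge. The mass thus left over is
        distributed over \<open>[p, b1]\<close>.\<close>
      define w where "w = 2 * b1 * (p - m) / (b1 - p)"
      have w: "0 \<le> w" "w * (b1 - p) = 2 * b1 * (p - m)" using False p b by (auto simp: w_def)
      have balance: "(c2 + b2) * p + (c2 + b2 - w) * (b1 - p) = 2 * b1 * (b2 - p)" 
        using w(2) by (simp add: m_def field_simps)
      have left: "(c2 + b2) * p \<le> (c1 + 3 * p) * (b2 - p)"
      proof -
        have "(c1 + 3 * p) * (b2 - p) - (c2 + b2) * p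
            = c1 * b2 + 2 * p * b2 - 3/2 * p^2 - (3/2 * p^2 + (c1 + c2) * p)" by (simp add: field_simps power2_eq_square)
        also have "\<dots> = (c1 - b1) * b2 + (p * (b2 - p) + p * b2) - p^2 / 2" unfolding mass by (simp add: field_simps power2_eq_square)
        also have "\<dots> \<ge> 0"
        proof -
          have "p * p \<le> p * b2" "0 \<le> p * p" "0 \<le> p * (b2 - p)" "0 \<le> (c1 - b1) * b2" using p pb2 c1 b by auto
          then show ?thesis unfolding power2_eq_square by linarith
        qed
        finally show ?thesis by simp
      qed
      have 1: "virtual_surplus c1 c2 b1 b2 (\<lambda>x y. u x y - v x y)
         \<le> integral {0..p} (\<lambda>y. (c1 - 2 * b1 + 3 * (1 * (p - y))) * \<psi> y) - 2 * b1 * integral {p..p} \<psi>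
           - c2 * (b1 - p) * \<psi> 0 + w * (b1 - p) * \<psi> p"
        unfolding \<psi>_def by (rule virtual_surplus_deviation_le[OF props w(1) balance left]) (use pb2 in auto)
      have "integral {0..p} (\<lambda>y. (3 * p - (2 * b1 - c1) - 3 * y) * \<psi> y) - (c2 * (b1 - p)) * \<psi> 0 + (w * (b1 - p)) * \<psi> p \<le> 0"
      proof (rule bundling_vertical_nonpos)
        show "convex_on {0..p} \<psi>" unfolding \<psi>_def by (rule deviation_average_convex[OF props]) (use pb2 in auto)
        show "continuous_on {0..p} \<psi>" unfolding \<psi>_def by (rule deviation_average_continuous[OF props]) (use pb2 in auto)
        show "\<psi> y' \<le> \<psi> y" if "0 \<le> y" "y \<le> y'" "y' \<le> p" for y y'
          unfolding \<psi>_def by (rule deviation_average_antimono[OF props, of p]) (use pb2 that in auto)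
        show "(3 * p - (2 * b1 - c1)) * p - 3/2 * p^2 + w * (b1 - p) = c2 * (b1 - p)"
          unfolding w(2) using mass by (simp add: m_def field_simps power2_eq_square)
      qed (use p w c disc False b in auto)
      moreover have "(\<lambda>y. (3 * p - (2 * b1 - c1) - 3 * y) * \<psi> y) = (\<lambda>y. (c1 - 2 * b1 + 3 * (1 * (p - y))) * \<psi> y)"
        by (simp add: algebra_simps)
      ultimately show ?thesis using 1 by simp
    qed
  qed
  finally show "virtual_surplus c1 c2 b1 b2 (\<lambda>x y. u x y - shifted_utility c1 c2 q t x y) \<le> 0" .
qed

subsection \<open>The price equation\<close>

text \<open>The right-hand side is the equality of the squares of the two formulas for
  \<open>a2\<close>, with \<open>p^2\<close> cancelled and denominators cleared.\<close>

lemma price_equation_factored: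
  fixes c1 c2 b1 b2 p :: real
  shows "2 * b1^2 * b2^2 * c1 - c1^2 * b1 * (b2 - c2)^2
         + p * (2 * b1^2 * b2^2 - 4 * b1 * b2 * c1 * c2 - 3 * c1 * b1 * (b2 - c2)^2)
         + p^2 * (2 * c2^2 * c1 - 4 * b1 * b2 * c2 - 9/4 * b1 * (b2 - c2)^2)
         + 2 * c2^2 * p^3
       = 2 * (p + c1) * (b1 * b2 - c2 * p)^2 - b1 * (b2 - c2)^2 * (3/2 * p + c1)^2"
proof -
  have "b1 * (b2 - c2)^2 * (3/2 * p + c1)^2 
      = c1^2 * b1 * (b2 - c2)^2 + p * (3 * c1 * b1 * (b2 - c2)^2) + p^2 * (9/4 * b1 * (b2 - c2)^2)"
    by (simp add: power2_sum algebra_simps) (simp add: power2_eq_square field_simps)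
  moreover have "2 * (p + c1) * (b1 * b2 - c2 * p)^2
      = 2 * b1^2 * b2^2 * c1 + p * (2 * b1^2 * b2^2 - 4 * b1 * b2 * c1 * c2)
        + p^2 * (2 * c2^2 * c1 - 4 * b1 * b2 * c2) + 2 * c2^2 * p^3"
    by (simp add: power2_eq_square power3_eq_cube algebra_simps)
  ultimately show ?thesis by (simp add: algebra_simps)
qed

text \<open>Intermediate value theorem. The sign at \<open>b1\<close> is automatic; at the left end
  it comes from \<open>up\<close> if that end is \<open>0\<close>, and from \<open>low\<close> if it
  is \<open>2 * b1 - c1\<close>.\<close>

lemma price_equation_solvable:
  fixes b1 b2 c1 c2 :: real
  assumes c: "0 \<le> c1" "0 \<le> c2" "c2 \<le> b2" and b: "0 < b1" "0 < b2"
    and low: "2 * b1 * (b2 + c2) \<le> c1 * (b2 + 3 * c2)" and up: "c1 * (b2 - c2)^2 \<le> 2 * b1 * b2^2" and c1: "b1 \<le> c1"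
  shows "\<exists>p\<in>{max (2 * b1 - c1) 0..b1}. 2 * (p + c1) * (b1 * b2 - c2 * p)^2 - b1 * (b2 - c2)^2 * (3/2 * p + c1)^2 = 0"
proof -
  let ?f = "\<lambda>p. 2 * (p + c1) * (b1 * b2 - c2 * p)^2 - b1 * (b2 - c2)^2 * (3/2 * p + c1)^2"
  let ?l = "max (2 * b1 - c1) 0"
  have "?f b1 = - (b1 * (b2 - c2)^2) * (b1^2 / 4 + b1 * c1 + c1^2)"
    by (simp add: power2_eq_square field_simps)
  also have "\<dots> \<le> 0" using b c by (intro mult_nonpos_nonneg) auto
  finally have fb: "?f b1 \<le> 0" .
  have fl: "0 \<le> ?f ?l"
  proof (cases "2 * b1 \<le> c1")
    case True
    have "?f 0 = (b1 * c1) * (2 * b1 * b2^2 - c1 * (b2 - c2)^2)" by (simp add: power2_eq_square algebra_simps)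
    also have "\<dots> \<ge> 0" using up b c by simp
    finally show ?thesis using True by simp
  next
    case False
    \<comment> \<open>Since \<open>P + c1 = 2 * b1\<close>, the price polynomial at \<open>P\<close>
      is \<open>b1\<close> times a difference of two squares, and \<open>low\<close> compares their
      bases.\<close>
    define P where "P = 2 * b1 - c1"
    have "(b2 - c2) * (3 * b1 - c1 / 2) \<le> 2 * (b1 * b2 - c2 * P)"
      using low by (simp add: P_def field_simps)
    moreover have "0 \<le> (b2 - c2) * (3 * b1 - c1 / 2)" using c False by simp
    ultimately have "((b2 - c2) * (3 * b1 - c1 / 2))^2 \<le> (2 * (b1 * b2 - c2 * P))^2" by (rule power_mono)
    then have "0 \<le> b1 * ((2 * (b1 * b2 - c2 * P))^2 - ((b2 - c2) * (3 * b1 - c1 / 2))^2)" using b by simp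
    also have "\<dots> = 2 * (P + c1) * (b1 * b2 - c2 * P)^2 - b1 * (b2 - c2)^2 * (3/2 * P + c1)^2"
    proof -
      have "P + c1 = 2 * b1" "3/2 * P + c1 = 3 * b1 - c1 / 2" by (simp_all add: P_def field_simps)
      moreover have "b1 * ((2 * X)^2 - (E * Y)^2) = 2 * (2 * b1) * X^2 - b1 * E^2 * Y^2" for X E Y
        by (simp add: power2_eq_square algebra_simps)
      ultimately show ?thesis by (simp only:)
    qed
    finally show ?thesis using False by (simp add: P_def)
  qed
  have "\<exists>p\<ge>?l. p \<le> b1 \<and> ?f p = 0"
    by (rule IVT2'[where f = ?f]) (use fb fl c1 b in \<open>auto intro!: continuous_intros\<close>)
  then show ?thesis by auto
qed

text \<open>The equality of the two formulas for \<open>a2\<close>, stated without the factor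
  \<open>p\<close> so that it also determines \<open>s\<close> when \<open>p = 0\<close>.\<close>

lemma price_equation_sqrt:
  fixes b1 b2 c1 c2 p :: real
  assumes eq: "2 * (p + c1) * (b1 * b2 - c2 * p)^2 - b1 * (b2 - c2)^2 * (3/2 * p + c1)^2 = 0"
    and "0 < c1" "0 \<le> p" "0 < b1" "c2 < b2" "0 < b1 * b2 - c2 * p"
  shows "sqrt (2 * (p + c1) / b1) = (b2 - c2) * (3/2 * p + c1) / (b1 * b2 - c2 * p)"
proof (rule real_sqrt_unique)
  have "((b2 - c2) * (3/2 * p + c1) / (b1 * b2 - c2 * p))^2 = b1 * (b2 - c2)^2 * (3/2 * p + c1)^2 / (b1 * (b1 * b2 - c2 * p)^2)"
    using assms by (simp add: power_divide power_mult_distrib)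
  also have "b1 * (b2 - c2)^2 * (3/2 * p + c1)^2 = 2 * (p + c1) * (b1 * b2 - c2 * p)^2" using eq by simp
  also have "\<dots> / (b1 * (b1 * b2 - c2 * p)^2) = 2 * (p + c1) / b1" using assms by (simp add: field_simps)
  finally show "((b2 - c2) * (3/2 * p + c1) / (b1 * b2 - c2 * p))^2 = 2 * (p + c1) / b1" .
qed (use assms in auto)

text \<open>\<open>P\<close> stands for \<open>2 * b1 - c1\<close>. Eliminating \<open>b2\<close>
  from \<open>low\<close> by means of \<open>mass\<close> gives a lower bound for \<open>c2\<close>
  in terms of \<open>p\<close>, \<open>P\<close> and \<open>b1\<close>; inserting it leaves a
  polynomial inequality in these three.\<close>

lemma bundle_price_discriminant:
  fixes b1 b2 c2 p P :: real
  assumes "0 < p" "p < P" "P < 3 * p" "p < b1" "P \<le> b1"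
    and low: "P * (b2 + 3 * c2) \<le> 4 * b1 * c2" and mass: "p * (3/2 * p + 2 * b1 - P + c2) = b1 * b2"
  shows "(3 * p - P)^2 \<le> 8 * (c2 * (b1 - p))"
proof -
  define Z where "Z = 4 * b1^2 - 3 * b1 * P - P * p"
  have "P * (b1 * b2) + 3 * (P * b1 * c2) \<le> 4 * b1^2 * c2"
    using mult_left_mono[OF low, of b1] assms by (simp add: power2_eq_square algebra_simps)
  then have c2Z: "P * p * (3/2 * p + 2 * b1 - P) \<le> c2 * Z"
    unfolding mass[symmetric] Z_def by (simp add: algebra_simps power2_eq_square)
  have "b1 * P \<le> b1 * b1" "P * p < P * b1" "P * b1 \<le> b1 * b1" using assms by auto
  then have Z: "0 < Z" by (simp add: Z_def power2_eq_square algebra_simps)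
  \<comment> \<open>The polynomial to be bounded vanishes at \<open>P = p\<close>; \<open>B\<close>
    is its quotient by \<open>P - p\<close>.\<close>
  define B where "B = (36 * p - 4 * P) * b1^2 - (23 * p - 3 * P) * (P * b1) + p * P * (P + 3 * p)"
  have "8 * (b1 - p) * (P * p * (3/2 * p + 2 * b1 - P)) - (3 * p - P)^2 * Z = (P - p) * B"
    by (simp add: Z_def B_def field_simps power2_eq_square)
  moreover have "0 \<le> B"
  proof -
    have "P * b1 \<le> b1^2" using assms by (simp add: power2_eq_square)
    then have "(23 * p - 3 * P) * (P * b1) \<le> (23 * p - 3 * P) * b1^2" using assms by (intro mult_left_mono) auto
    moreover have "0 \<le> (13 * p - P) * b1^2" "0 \<le> p * P * (P + 3 * p)" using assms by (auto intro!: mult_nonneg_nonneg)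
    ultimately show ?thesis by (simp add: B_def algebra_simps)
  qed
  then have "0 \<le> (P - p) * B" using assms by simp
  moreover have "8 * (b1 - p) * (P * p * (3/2 * p + 2 * b1 - P)) \<le> 8 * (b1 - p) * (c2 * Z)"
    using c2Z assms by (intro mult_left_mono) auto
  ultimately have "(3 * p - P)^2 * Z \<le> (8 * (c2 * (b1 - p))) * Z" by (simp add: algebra_simps)
  then show ?thesis using Z by simp
qed

text \<open>
  The price equation at \<open>r\<close> equates the squares of the two expressions for \<open>a\<^sub>2\<close>. Passing to a
  smaller price changes their ratio monotonically, and at \<open>p\<close> the first expression equals \<open>1\<close>.
\<close>

lemma bundle_price_moment:
  fixes b1 b2 c1 c2 p r :: real
  assumes eq: "2 * (r + c1) * (b1 * b2 - c2 * r)^2 = b1 * (b2 - c2)^2 * (3/2 * r + c1)^2"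
    and "0 < c1" "0 \<le> c2" "0 \<le> p" "p \<le> r" "0 \<le> b1 * b2 - c2 * r"
    and mass: "p * (3/2 * p + c1) = b1 * b2 - c2 * p"
  shows "b1 * (b2 - c2)^2 \<le> 2 * p^2 * (c1 + p)"
proof -
  let ?Y = "3/2 * p + c1" and ?R = "3/2 * r + c1"
  \<comment> \<open>In other words, \<open>(x + c1) / (3/2 * x + c1)^2\<close> decreases in
    \<open>x\<close>.\<close>
  have "(p + c1) * ?R^2 - (r + c1) * ?Y^2 = (r - p) * (9/4 * p * r + 2 * c1^2 + 9/4 * c1 * (r + p))"
    by (simp add: power2_eq_square field_simps)
  also have "\<dots> \<ge> 0" using assms by (intro mult_nonneg_nonneg) auto
  finally have 1: "(r + c1) * ?Y^2 \<le> (p + c1) * ?R^2" by simp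
  have "c2 * p \<le> c2 * r" using assms by (intro mult_left_mono) auto
  then have 2: "(b1 * b2 - c2 * r)^2 \<le> (p * ?Y)^2" unfolding mass using assms by (intro power_mono) auto
  have "b1 * (b2 - c2)^2 * ?R^2 * ?Y^2 = 2 * (b1 * b2 - c2 * r)^2 * ((r + c1) * ?Y^2)"
    unfolding eq[symmetric] by (simp only: ac_simps)
  also have "\<dots> \<le> 2 * (p * ?Y)^2 * ((p + c1) * ?R^2)"
    by (intro mult_mono[OF mult_left_mono[OF 2] 1]) (use assms in auto)
  also have "\<dots> = 2 * p^2 * (c1 + p) * ?R^2 * ?Y^2" by (simp only: power_mult_distrib ac_simps)
  finally have "(b1 * (b2 - c2)^2) * (?R^2 * ?Y^2) \<le> (2 * p^2 * (c1 + p)) * (?R^2 * ?Y^2)" by (simp only: mult.assoc)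
  moreover have "0 < ?R^2 * ?Y^2" using assms by (intro mult_pos_pos zero_less_power) auto
  ultimately show ?thesis by (simp only: mult_le_cancel_right_pos)
qed

text \<open>With \<open>c = c1 + c2\<close> the quadratic equation says that the first formula for
  \<open>a2\<close> equals \<open>1\<close> at \<open>p\<close> (for \<open>c2 < b2\<close>), which
  is zero total mass for the bundle.\<close>

lemma bundle_price:
  fixes b1 b2 c :: real
  assumes "0 \<le> c" "0 < b1" "0 < b2"
  defines "p \<equiv> (sqrt (c^2 + 6 * b1 * b2) - c) / 3"
  shows "0 < p" "3/2 * p^2 + c * p = b1 * b2"
proof -
  have pos: "0 < 6 * b1 * b2" using assms by simp
  have "sqrt (c^2) < sqrt (c^2 + 6 * b1 * b2)" using pos by (intro real_sqrt_less_mono) simp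
  then show "0 < p" using assms by simp
  have "3 * p + c = sqrt (c^2 + 6 * b1 * b2)" unfolding p_def by (simp add: field_simps)
  then have "(3 * p + c)^2 = c^2 + 6 * b1 * b2" using pos by simp
  then show "3/2 * p^2 + c * p = b1 * b2" by (simp add: power2_eq_square field_simps)
qed

text \<open>\<open>A\<close> and \<open>A + B\<close> are the utilities from buying
  \<open>(1, a)\<close> and \<open>(1, 1)\<close>. By the hypothesis on \<open>p\<close> the region
  without sale stays below the height where \<open>B\<close> changes sign.\<close>

lemma a2_menu_allocation:
  assumes ind: "induced D (a2_menu c1 c2 b2 p a) q t" and z: "(z1, z2) \<in> D" and z1: "c1 \<le> z1"
    and a: "0 \<le> a" "a \<le> 1" and p: "p \<le> a * ((b2 - c2) / 2)"
  shows "(z1 - c1) + a * (z2 - c2) < p \<Longrightarrow> q (z1, z2) = (0, 0)"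
    and "c2 + (b2 - c2) / 2 < z2 \<Longrightarrow> q (z1, z2) = (1, 1)"
    and "p < (z1 - c1) + a * (z2 - c2) \<Longrightarrow> z2 < c2 + (b2 - c2) / 2 \<Longrightarrow> q (z1, z2) = (1, a)"
proof -
  define m where "m = (b2 - c2) / 2"
  define x where "x = z1 - c1"
  define y where "y = z2 - c2"
  have z_eq: "(z1, z2) = (c1 + x, c2 + y)" by (simp add: x_def y_def)
  have x: "0 \<le> x" using z1 by (simp add: x_def)
  define A where "A = x + a * y - p"
  define B where "B = (1 - a) * (y - m)"
  have third: "x + y - p - (1 - a) * m = A + B" by (simp add: A_def B_def algebra_simps)
  have "shifted_utility c1 c2 q t x y = max 0 (max (x + a * y - p) (x + y - p - (1 - a) * m))"
    unfolding m_def using a2_menu_utility[OF ind] z z_eq by simp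
  then have u: "shifted_utility c1 c2 q t x y = max 0 (max A (A + B))" unfolding third A_def[symmetric] .
  have "(q (z1, z2), t (z1, z2)) \<in> a2_menu c1 c2 b2 p a" using ind z unfolding induced_def by blast
  then have "(q (z1, z2) = (0, 0) \<and> shifted_utility c1 c2 q t x y = 0)
    \<or> (q (z1, z2) = (1, a) \<and> shifted_utility c1 c2 q t x y = x + a * y - p)
    \<or> (q (z1, z2) = (1, 1) \<and> shifted_utility c1 c2 q t x y = x + y - p - (1 - a) * m)"
    unfolding a2_menu_def shifted_utility_def z_eq[symmetric] by (auto simp: x_def y_def m_def field_simps)
  then consider "q (z1, z2) = (0, 0)" "max 0 (max A (A + B)) = 0"
    | "q (z1, z2) = (1, a)" "max 0 (max A (A + B)) = A"
    | "q (z1, z2) = (1, 1)" "max 0 (max A (A + B)) = A + B"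
    unfolding third A_def[symmetric] u by blast
  note cases = this
  have am: "a * m \<le> a * y" if "m \<le> y" using that a by (intro mult_left_mono) auto
  show "q (z1, z2) = (0, 0)" if "(z1 - c1) + a * (z2 - c2) < p"
  proof -
    have neg: "A < 0" using that by (simp add: A_def x_def y_def)
    have "\<not> m \<le> y" using am neg p x by (auto simp: A_def m_def)
    then have "B \<le> 0" unfolding B_def using a by (intro mult_nonneg_nonpos) auto
    with neg show ?thesis by (cases rule: cases) auto
  qed
  show "q (z1, z2) = (1, 1)" if "c2 + (b2 - c2) / 2 < z2"
  proof -
    have y: "m < y" using that unfolding y_def m_def by linarith
    then have A: "0 \<le> A" using am p x by (auto simp: A_def m_def)
    \<comment> \<open>For \<open>a = 1\<close> the two nonzero entries coincide, and strict
      positivity of \<open>A\<close> is needed to exclude \<open>(0, 0)\<close>.\<close>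
    show ?thesis
    proof (cases "a = 1")
      case True
      then have "0 < A" "B = 0" using y p x by (auto simp: A_def B_def m_def)
      then show ?thesis using True by (cases rule: cases) auto
    next
      case False
      then have "0 < B" unfolding B_def using a y by (intro mult_pos_pos) auto
      with A show ?thesis by (cases rule: cases) auto
    qed
  qed
  show "q (z1, z2) = (1, a)" if "p < (z1 - c1) + a * (z2 - c2)" "z2 < c2 + (b2 - c2) / 2"
  proof -
    have A: "0 < A" using that by (simp add: A_def x_def y_def)
    have y: "y < m" using that unfolding y_def m_def by linarith
    show ?thesis
    proof (cases "a = 1")
      case True
      with A show ?thesis by (cases rule: cases) auto
    next
      case False
      then have "B < 0" unfolding B_def using a y by (intro mult_pos_neg) auto
      with A show ?thesis by (cases rule: cases) auto
    qed
  qed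
qed

theorem theorem6:
  fixes c1 c2 b1 b2 :: real and D :: "(real \<times> real) set"
  assumes "c1 \<ge> 0" and "c2 \<ge> 0" and "b1 > 0" and "b2 > 0"
    and "D = {c1..c1 + b1} \<times> {c2..c2 + b2}"
    and "c2 \<le> b2"
    and "2 * b1 * (b2 + c2) / (b2 + 3 * c2) \<le> c1"
    and "c2 \<noteq> b2 \<Longrightarrow> c1 \<le> 2 * b1 * (b2 / (b2 - c2))^2"
  defines "is_pa2 \<equiv> \<lambda>p. p \<in> {max (2 * b1 - c1) 0..b1} \<and>
       2 * b1^2 * b2^2 * c1 - c1^2 * b1 * (b2 - c2)^2
         + p * (2 * b1^2 * b2^2 - 4 * b1 * b2 * c1 * c2 - 3 * c1 * b1 * (b2 - c2)^2)
         + p^2 * (2 * c2^2 * c1 - 4 * b1 * b2 * c2 - 9/4 * b1 * (b2 - c2)^2)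
         + 2 * c2^2 * p^3 = 0"
  shows "(\<exists>p. is_pa2 p) \<and>
    (\<forall>p. is_pa2 p \<longrightarrow>
       a2 c1 c2 b1 b2 p = a2' c1 c2 b1 b2 p \<and>
       (a2 c1 c2 b1 b2 p \<le> 1 \<longrightarrow>
          (let a = real_of_ereal (a2 c1 c2 b1 b2 p) in
             optimal_menu D (a2_menu c1 c2 b2 p a) \<and>
             (\<forall>q t. induced D (a2_menu c1 c2 b2 p a) q t \<longrightarrow>
                (\<forall>(z1, z2)\<in>D.
                   ((z1 - c1) + a * (z2 - c2) < p \<longrightarrow> q (z1, z2) = (0, 0)) \<and>
                   (z2 > c2 + (b2 - c2) / 2 \<longrightarrow> q (z1, z2) = (1, 1)) \<and>
                   ((z1 - c1) + a * (z2 - c2) > p \<and> z2 < c2 + (b2 - c2) / 2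
                      \<longrightarrow> q (z1, z2) = (1, a)))))) \<and>
       (a2 c1 c2 b1 b2 p > 1 \<longrightarrow> optimal_menu D (bundling_menu c1 c2 b1 b2)))"
proof -
  have low: "2 * b1 * (b2 + c2) \<le> c1 * (b2 + 3 * c2)"
    using assms(7) \<open>0 \<le> c2\<close> \<open>0 < b2\<close> by (simp add: divide_le_eq)
  have "b1 * (b2 + 3 * c2) \<le> 2 * b1 * (b2 + c2)" using \<open>0 < b1\<close> \<open>c2 \<le> b2\<close> by (simp add: algebra_simps)
  then have "b1 * (b2 + 3 * c2) \<le> c1 * (b2 + 3 * c2)" using low by linarith
  then have b1c1: "b1 \<le> c1" using \<open>0 \<le> c2\<close> \<open>0 < b2\<close> by simp
  then have c1: "0 < c1" using \<open>0 < b1\<close> by simp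
  have up: "c1 * (b2 - c2)^2 \<le> 2 * b1 * b2^2"
  proof (cases "c2 = b2")
    case False
    then have "0 < (b2 - c2)^2" by simp
    then show ?thesis using assms(8)[OF False] by (simp add: power_divide pos_le_divide_eq)
  qed (use \<open>0 < b1\<close> in simp)
  have pa2: "is_pa2 p \<longleftrightarrow> max (2 * b1 - c1) 0 \<le> p \<and> p \<le> b1 \<and>
      2 * (p + c1) * (b1 * b2 - c2 * p)^2 - b1 * (b2 - c2)^2 * (3/2 * p + c1)^2 = 0" for p
    unfolding is_pa2_def price_equation_factored by simp
  have 1: "\<exists>p. is_pa2 p"
    using price_equation_solvable[OF assms(1,2,6,3,4) low up b1c1] unfolding pa2 by auto
  have 2: "a2 c1 c2 b1 b2 p = a2' c1 c2 b1 b2 p \<and>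
       (a2 c1 c2 b1 b2 p \<le> 1 \<longrightarrow>
          (let a = real_of_ereal (a2 c1 c2 b1 b2 p) in
             optimal_menu D (a2_menu c1 c2 b2 p a) \<and>
             (\<forall>q t. induced D (a2_menu c1 c2 b2 p a) q t \<longrightarrow>
                (\<forall>(z1, z2)\<in>D.
                   ((z1 - c1) + a * (z2 - c2) < p \<longrightarrow> q (z1, z2) = (0, 0)) \<and>
                   (z2 > c2 + (b2 - c2) / 2 \<longrightarrow> q (z1, z2) = (1, 1)) \<and>
                   ((z1 - c1) + a * (z2 - c2) > p \<and> z2 < c2 + (b2 - c2) / 2
                      \<longrightarrow> q (z1, z2) = (1, a)))))) \<and>
       (a2 c1 c2 b1 b2 p > 1 \<longrightarrow> optimal_menu D (bundling_menu c1 c2 b1 b2))" if "is_pa2 p" for p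
  proof -
    from that have p: "2 * b1 - c1 \<le> p" "0 \<le> p" "p \<le> b1"
      and eq: "2 * (p + c1) * (b1 * b2 - c2 * p)^2 - b1 * (b2 - c2)^2 * (3/2 * p + c1)^2 = 0"
      unfolding pa2 by auto
    have X: "0 < b1 * b2 - c2 * p" if "c2 < b2"
    proof -
      have "c2 * p \<le> c2 * b1" using p \<open>0 \<le> c2\<close> by (intro mult_left_mono) auto
      also have "\<dots> < b2 * b1" using that \<open>0 < b1\<close> by simp
      finally show ?thesis by (simp add: mult.commute)
    qed
    have a2_eq: "a2 c1 c2 b1 b2 p = a2' c1 c2 b1 b2 p"
    proof (cases "c2 = b2")
      case False
      then have "c2 < b2" using \<open>c2 \<le> b2\<close> by simp
      with price_equation_sqrt[OF eq c1 p(2) \<open>0 < b1\<close> this X[OF this]] show ?thesis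
        by (simp add: a2_def a2'_def)
    qed (simp add: a2_def a2'_def)
    have menu: "optimal_menu D (a2_menu c1 c2 b2 p a) \<and>
        (\<forall>q t. induced D (a2_menu c1 c2 b2 p a) q t \<longrightarrow>
           (\<forall>(z1, z2)\<in>D.
              ((z1 - c1) + a * (z2 - c2) < p \<longrightarrow> q (z1, z2) = (0, 0)) \<and>
              (z2 > c2 + (b2 - c2) / 2 \<longrightarrow> q (z1, z2) = (1, 1)) \<and>
              ((z1 - c1) + a * (z2 - c2) > p \<and> z2 < c2 + (b2 - c2) / 2 \<longrightarrow> q (z1, z2) = (1, a))))"
      if le: "a2 c1 c2 b1 b2 p \<le> 1" and a_def: "a = real_of_ereal (a2 c1 c2 b1 b2 p)" for a
    proof -
      have "c2 \<noteq> b2" using le by (auto simp: a2_def)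
      then have cb: "c2 < b2" using \<open>c2 \<le> b2\<close> by simp
      define r where "r = sqrt (2 * (p + c1) / b1)"
      \<comment> \<open>\<open>s = p / a\<close>, in a form that is also right for \<open>a = p = 0\<close>\<close>
      define s where "s = (b2 - c2) / r"
      have r2: "r^2 = 2 * (p + c1) / b1" using c1 p \<open>0 < b1\<close> by (simp add: r_def)
      have r: "0 < r" using c1 p \<open>0 < b1\<close> by (simp add: r_def)
      \<comment> \<open>The bound \<open>2 * b1 - c1 \<le> p\<close> enters here; it gives
        \<open>s \<le> (b2 - c2) / 2\<close>.\<close>
      have "2^2 \<le> 2 * (p + c1) / b1" using p \<open>0 < b1\<close> by (simp add: field_simps)
      then have r_ge: "2 \<le> r" unfolding r_def by (rule real_le_rsqrt)
      have aX: "a = p * ((3/2 * p + c1) / (b1 * b2 - c2 * p))" using cb by (simp add: a_def a2_def)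
      have "a = p / (b2 - c2) * r" using cb by (simp add: a_def a2_eq a2'_def r_def)
      then have as: "p = a * s" using cb r by (simp add: s_def)
      have a: "0 \<le> a" "a \<le> 1" using le cb X[OF cb] p c1 unfolding aX a2_def by simp_all
      have s: "0 < s" using cb r by (simp add: s_def)
      have "(b2 - c2) / r \<le> (b2 - c2) / 2" using cb r_ge by (intro divide_left_mono) auto
      then have sm: "s \<le> (b2 - c2) / 2" by (simp add: s_def)
      have mass: "s * (3/2 * p + c1) = b1 * b2 - c2 * p"
      proof -
        have cancel: "d / (d * Y / X) * Y = X" if "d \<noteq> 0" "Y \<noteq> 0" "X \<noteq> 0" for d X Y :: real
          using that by simp
        show ?thesis
          unfolding s_def r_def price_equation_sqrt[OF eq c1 p(2) \<open>0 < b1\<close> cb X[OF cb]]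
          by (rule cancel) (use cb X[OF cb] c1 p(2) in auto)
      qed
      have moment: "2 * s^2 * (c1 + p) = b1 * (b2 - c2)^2"
        unfolding s_def power_divide r2 using c1 p \<open>0 < b1\<close> by (simp add: field_simps)
      \<comment> \<open>The averaging interval \<open>[p, b1]\<close> must have positive length. At
        \<open>b1\<close> the price polynomial is strictly negative because
        \<open>c2 < b2\<close>.\<close>
      have "p \<noteq> b1"
      proof
        assume "p = b1"
        then have "2 * (b1 + c1) * (b1 * b2 - c2 * b1)^2 - b1 * (b2 - c2)^2 * (3/2 * b1 + c1)^2 = 0" using eq by simp
        moreover have "2 * (b1 + c1) * (b1 * b2 - c2 * b1)^2 - b1 * (b2 - c2)^2 * (3/2 * b1 + c1)^2
           = - (b1 * (b2 - c2)^2 * (b1^2 / 4 + b1 * c1 + c1^2))"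
          by (simp add: power2_eq_square field_simps)
        moreover have "0 < b1 * (b2 - c2)^2 * (b1^2 / 4 + b1 * c1 + c1^2)"
          using \<open>0 < b1\<close> c1 cb by (intro mult_pos_pos add_pos_pos) auto
        ultimately show False by linarith
      qed
      then have pb: "p < b1" using p by simp
      have "p \<le> a * ((b2 - c2) / 2)" unfolding as using sm a by (intro mult_left_mono) auto
      then show ?thesis
        using a2_menu_optimal[OF assms(5,1,2,3,4) a s sm as pb p(1) mass moment]
          a2_menu_allocation[OF _ _ _ a] assms(5) by auto
    qed
    have bundling: "optimal_menu D (bundling_menu c1 c2 b1 b2)" if gt: "a2 c1 c2 b1 b2 p > 1"
    proof -
      define p' where "p' = (sqrt ((c1 + c2)^2 + 6 * b1 * b2) - (c1 + c2)) / 3"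
      have p': "0 < p'" and mass: "3/2 * p'^2 + (c1 + c2) * p' = b1 * b2"
        unfolding p'_def using assms(1-4) bundle_price[of "c1 + c2" b1 b2] by auto
      have mass': "p' * (3/2 * p' + c1) = b1 * b2 - c2 * p'"
        using mass by (simp add: power2_eq_square field_simps)
      have "p' < b1 \<and> b1 * (b2 - c2)^2 \<le> 2 * p'^2 * (c1 + p')"
      proof (cases "c2 = b2")
        \<comment> \<open>Here \<open>a2\<close> is infinite. The left-hand side of the moment
          inequality vanishes, and \<open>p' < b1\<close> follows from the mass equation.\<close>
        case True
        have "b2 * p' < b2 * b1"
        proof -
          have "0 < p'^2" "0 < c1 * p'" using p' c1 by auto
          moreover have "3/2 * p'^2 + c1 * p' + b2 * p' = b2 * b1" using mass True by (simp add: algebra_simps)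
          ultimately show ?thesis by linarith
        qed
        then show ?thesis using True \<open>0 < b2\<close> p' c1 by simp
      next
        case False
        then have cb: "c2 < b2" using \<open>c2 \<le> b2\<close> by simp
        have "1 < p * ((3/2 * p + c1) / (b1 * b2 - c2 * p))" using gt cb by (simp add: a2_def)
        then have gt': "b1 * b2 - c2 * p < p * (3/2 * p + c1)" using X[OF cb] by (simp add: field_simps)
        \<comment> \<open>The function \<open>x * (3/2 * x + c1) + c2 * x\<close> increases; it
          equals \<open>b1 * b2\<close> at \<open>p'\<close>, and \<open>a2 > 1\<close> says that it
          exceeds \<open>b1 * b2\<close> at \<open>p\<close>.\<close>
        have "p' < p"
        proof (rule ccontr)
          assume "\<not> p' < p"
          then have "p * (3/2 * p + c1) \<le> p' * (3/2 * p' + c1)" "c2 * p \<le> c2 * p'"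
            using p c1 \<open>0 \<le> c2\<close> by (auto intro!: mult_mono mult_left_mono)
          then show False using gt' mass' by linarith
        qed
        moreover have "2 * (p + c1) * (b1 * b2 - c2 * p)^2 = b1 * (b2 - c2)^2 * (3/2 * p + c1)^2" using eq by simp
        from bundle_price_moment[OF this c1 \<open>0 \<le> c2\<close> _ _ _ mass'] have "b1 * (b2 - c2)^2 \<le> 2 * p'^2 * (c1 + p')"
          using p' \<open>p' < p\<close> X[OF cb] by simp
        ultimately show ?thesis using p by simp
      qed
      then have pb: "p' < b1" and moment: "b1 * (b2 - c2)^2 \<le> 2 * p'^2 * (c1 + p')" by auto
      have disc: "(3 * p' - (2 * b1 - c1))^2 \<le> 8 * (c2 * (b1 - p'))" if "p' < 2 * b1 - c1" "2 * b1 - c1 < 3 * p'"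
      proof (rule bundle_price_discriminant[OF p' that pb])
        show "(2 * b1 - c1) * (b2 + 3 * c2) \<le> 4 * b1 * c2" using low by (simp add: algebra_simps)
        show "p' * (3/2 * p' + 2 * b1 - (2 * b1 - c1) + c2) = b1 * b2" using mass by (simp add: power2_eq_square algebra_simps)
      qed (use b1c1 in simp)
      have "optimal_menu D {((0, 0), 0), ((1, 1), c1 + c2 + p')}"
        by (rule bundling_optimal[OF assms(5,1,2,3,4) b1c1 p' pb mass moment assms(6) disc])
      moreover have "bundling_menu c1 c2 b1 b2 = {((0, 0), 0), ((1, 1), c1 + c2 + p')}"
        by (simp add: bundling_menu_def p'_def diff_diff_eq)
      ultimately show ?thesis by simp
    qed
    show ?thesis
      unfolding Let_def by (rule conjI[OF a2_eq conjI[OF impI[OF menu[OF _ refl]] impI[OF bundling]]])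
  qed
  show ?thesis by (rule conjI[OF 1]) (intro allI impI 2)
qed

end
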